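(* Let $\gamma\in H$ be given, and let $\mu\in H$ be a solution of \[ \mu-\mathbf N\mu=-\mathbf M\gamma . \] Define \[ \Phi(z):=\frac{1}{2\pi i}\int_\Gamma\frac{\gamma+i\mu}{A}\,\frac{d\eta}{\eta-z},\qquad z\notin\Gamma, \] and let $f:=\Phi$ in $G$. Then the boundary values of $f$ from $G$ satisfy \[ Af^+=\gamma+h+i\mu,\qquad\text{where}\qquad h=\tfrac12\bigl[\mathbf M\mu-(\mathbf I-\mathbf N)\gamma\bigr]\in S^- . \]
   Context: $G$ is an unbounded multiply connected region of connectivity $m$ with $\infty\in G$ and $0\in G$. Its boundary is $\Gamma=\Gamma_1\cup\dots\cup\Gamma_m$, consisting of simple, non-intersecting, smooth, clockwise oriented closed curves, so that $G$ lies to the left of $\Gamma$. $G^-:=(\mathbb C\cup\{\infty\})\setminus(G\cup\Gamma)$ is the union of the bounded simply connected regions $G_k$ enclosed by $\Gamma_k$. Each $\Gamma_k$ is parametrized by a $2\pi$-periodic, twice continuously differentiable function $\eta_k$ with $\dot\eta_k\ne0$. $J$ is the disjoint union of $J_k=[0,2\pi]$, and $\eta=\eta_k$ on $J_k$. $H$ is the space of real functions on $J$ that are Hölder continuous and $2\pi$-periodic on each $J_k$. Functions on $\Gamma$ are identified with functions on $J$ via $\eta$. $A$ is a nonvanishing complex function on $\Gamma$ with continuously differentiable parametric form $A(t)$, $t\in J$. The real kernels are given by \[ M(s,t)+iN(s,t):=\frac1\pi\frac{A(s)}{A(t)}\frac{\dot\eta(t)}{\eta(t)-\eta(s)} . \]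 The operators are $\mathbf N\mu(s)=\int_J N(s,t)\mu(t)\,dt$ and $\mathbf M\mu(s)=\int_J M(s,t)\mu(t)\,dt$ (principal value). $\mathbf I$ is the identity. $S^-:=\{\gamma\in H:\ \gamma=Ag^- \text{ for some } g \text{ analytic in } G^-\}$, where $g^-$ is the boundary value of $g$ from $G^-$. That is, $S^-$ consists of the real functions of the form $Ag^-$. *)

theory Defs
  imports "HOL-Complex_Analysis.Complex_Analysis"
begin

text \<open>Components J_k are indexed by k < m (0-based). A function on J is a
  map nat => real => real (component index, parameter).\<close>

definition periodic2pi :: "(real \<Rightarrow> 'a) \<Rightarrow> bool" where
  "periodic2pi f \<longleftrightarrow> (\<forall>t. f (t + 2 * pi) = f t)"

definition holder_on :: "real set \<Rightarrow> (real \<Rightarrow> real) \<Rightarrow> bool" where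
  "holder_on S f \<longleftrightarrow> (\<exists>C \<alpha>. 0 < \<alpha> \<and> \<alpha> \<le> 1 \<and>
      (\<forall>s\<in>S. \<forall>t\<in>S. \<bar>f s - f t\<bar> \<le> C * \<bar>s - t\<bar> powr \<alpha>))"

definition in_H :: "nat \<Rightarrow> (nat \<Rightarrow> real \<Rightarrow> real) \<Rightarrow> bool" where
  "in_H m \<mu> \<longleftrightarrow> (\<forall>k<m. periodic2pi (\<mu> k) \<and> holder_on {0..2 * pi} (\<mu> k))"

definition C1_fun :: "(real \<Rightarrow> complex) \<Rightarrow> bool" where
  "C1_fun f \<longleftrightarrow> (\<exists>f1. (\<forall>t. (f has_vector_derivative f1 t) (at t)) \<and> continuous_on UNIV f1)"

definition C2_fun :: "(real \<Rightarrow> complex) \<Rightarrow> bool" where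
  "C2_fun f \<longleftrightarrow> (\<exists>f1 f2. (\<forall>t. (f has_vector_derivative f1 t) (at t)) \<and>
      (\<forall>t. (f1 has_vector_derivative f2 t) (at t)) \<and> continuous_on UNIV f2)"

definition cpath :: "(nat \<Rightarrow> real \<Rightarrow> complex) \<Rightarrow> nat \<Rightarrow> real \<Rightarrow> complex" where
  "cpath eta k = (\<lambda>s. eta k (2 * pi * s))"

definition Gamma_bd :: "nat \<Rightarrow> (nat \<Rightarrow> real \<Rightarrow> complex) \<Rightarrow> complex set" where
  "Gamma_bd m eta = (\<Union>k<m. path_image (cpath eta k))"

definition Gminus :: "nat \<Rightarrow> (nat \<Rightarrow> real \<Rightarrow> complex) \<Rightarrow> complex set" where
  "Gminus m eta = (\<Union>k<m. inside (path_image (cpath eta k)))"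

definition Gregion :: "nat \<Rightarrow> (nat \<Rightarrow> real \<Rightarrow> complex) \<Rightarrow> complex set" where
  "Gregion m eta = - (Gamma_bd m eta \<union> Gminus m eta)"

definition admissible_curves :: "nat \<Rightarrow> (nat \<Rightarrow> real \<Rightarrow> complex) \<Rightarrow> bool" where
  "admissible_curves m eta \<longleftrightarrow>
     (\<forall>k<m. periodic2pi (eta k) \<and> C2_fun (eta k) \<and>
        (\<forall>t. vector_derivative (eta k) (at t) \<noteq> 0) \<and>
        simple_path (cpath eta k) \<and>
        (\<forall>z\<in>inside (path_image (cpath eta k)). winding_number (cpath eta k) z = -1)) \<and>
     (\<forall>j<m. \<forall>k<m. j \<noteq> k \<longrightarrow>
        (path_image (cpath eta j) \<union> inside (path_image (cpath eta j))) \<inter>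
        (path_image (cpath eta k) \<union> inside (path_image (cpath eta k))) = {})"

definition admissible_A :: "nat \<Rightarrow> (nat \<Rightarrow> real \<Rightarrow> complex) \<Rightarrow> bool" where
  "admissible_A m A \<longleftrightarrow> (\<forall>k<m. periodic2pi (A k) \<and> C1_fun (A k) \<and> (\<forall>t. A k t \<noteq> 0))"

definition kernelMN :: "(nat \<Rightarrow> real \<Rightarrow> complex) \<Rightarrow> (nat \<Rightarrow> real \<Rightarrow> complex) \<Rightarrow>
    nat \<Rightarrow> real \<Rightarrow> nat \<Rightarrow> real \<Rightarrow> complex" where
  "kernelMN eta A j s k t =
     (1 / complex_of_real pi) * (A j s / A k t) * (vector_derivative (eta k) (at t) / (eta k t - eta j s))"

definition kM :: "(nat \<Rightarrow> real \<Rightarrow> complex) \<Rightarrow> (nat \<Rightarrow> real \<Rightarrow> complex) \<Rightarrow>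
    nat \<Rightarrow> real \<Rightarrow> nat \<Rightarrow> real \<Rightarrow> real" where
  "kM eta A j s k t = Re (kernelMN eta A j s k t)"

definition kN :: "(nat \<Rightarrow> real \<Rightarrow> complex) \<Rightarrow> (nat \<Rightarrow> real \<Rightarrow> complex) \<Rightarrow>
    nat \<Rightarrow> real \<Rightarrow> nat \<Rightarrow> real \<Rightarrow> real" where
  "kN eta A j s k t = Im (kernelMN eta A j s k t)"

text \<open>Integral operator over J with kernel K, taken as a principal value on the
  component containing s (the integrand is 2pi-periodic in t, so the period
  window [s-pi, s+pi] is used, with the symmetric neighbourhood of s removed).\<close>
definition int_op :: "(nat \<Rightarrow> real \<Rightarrow> nat \<Rightarrow> real \<Rightarrow> real) \<Rightarrow> nat \<Rightarrow>
    (nat \<Rightarrow> real \<Rightarrow> real) \<Rightarrow> nat \<Rightarrow> real \<Rightarrow> real" where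
  "int_op K m \<mu> j s =
     (\<Sum>k<m. if k = j
        then Lim (at_right 0)
               (\<lambda>\<epsilon>. integral ({s - pi..s + pi} - {s - \<epsilon><..<s + \<epsilon>}) (\<lambda>t. K j s k t * \<mu> k t))
        else integral {0..2 * pi} (\<lambda>t. K j s k t * \<mu> k t))"

definition Phi :: "nat \<Rightarrow> (nat \<Rightarrow> real \<Rightarrow> complex) \<Rightarrow> (nat \<Rightarrow> real \<Rightarrow> complex) \<Rightarrow>
    (nat \<Rightarrow> real \<Rightarrow> real) \<Rightarrow> (nat \<Rightarrow> real \<Rightarrow> real) \<Rightarrow> complex \<Rightarrow> complex" where
  "Phi m eta A \<gamma> \<mu> z = 1 / (2 * pi * \<i>) *
     (\<Sum>k<m. integral {0..2 * pi}
        (\<lambda>t. (complex_of_real (\<gamma> k t) + \<i> * complex_of_real (\<mu> k t)) / A k t *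
             vector_derivative (eta k) (at t) / (eta k t - z)))"

definition in_Sminus :: "nat \<Rightarrow> (nat \<Rightarrow> real \<Rightarrow> complex) \<Rightarrow> (nat \<Rightarrow> real \<Rightarrow> complex) \<Rightarrow>
    (nat \<Rightarrow> real \<Rightarrow> real) \<Rightarrow> bool" where
  "in_Sminus m eta A h \<longleftrightarrow> in_H m h \<and>
     (\<exists>g. g analytic_on Gminus m eta \<and>
        (\<forall>j<m. \<forall>s\<in>{0..2 * pi}. \<exists>gm. (g \<longlongrightarrow> gm) (at (eta j s) within Gminus m eta) \<and>
              complex_of_real (h j s) = A j s * gm))"

end

theory Submission
  imports Defs
begin

text \<open>
  Put \<open>\<psi> = (\<gamma> + \<i>\<mu>)/A\<close>.  The function \<open>A\<close> times the principal value of the Cauchy integral of \<open>\<psi>\<close> has real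
  part \<open>\<pi> (M\<gamma> - N\<mu>)\<close> and imaginary part \<open>\<pi> (N\<gamma> + M\<mu>)\<close>.  The integral equation says that the former is
  \<open>- \<pi> \<mu>\<close>, so the jump relations of Sokhotski and Plemelj give \<open>A \<Phi>\<^sup>+ = \<gamma> + h + \<i>\<mu>\<close> and \<open>A \<Phi>\<^sup>- = h\<close>.

  The jump relations follow from
  \<open>\<integral> \<psi> d\<eta>/(\<eta> - z) = \<integral> (\<psi> - \<psi>(s)) d\<eta>/(\<eta> - z) + \<psi>(s) \<integral> d\<eta>/(\<eta> - z)\<close>: the first integral is continuous up to
  the curve by dominated convergence, if \<open>\<eta>(s)\<close> is taken nearest to \<open>z\<close>, and the second one is a winding
  number, with principal value \<open>- \<pi>\<i>\<close> on the curve.  To get that value without a local form of the Jordan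
  curve theorem, one approaches the curve along the normal: the limits from the two sides differ from
  the principal value by \<open>\<plusminus>\<pi>\<i>\<close>, and both belong to \<open>{0, - 2\<pi>\<i>}\<close>.
\<close>

subsection \<open>Periodic and Hoelder continuous functions\<close>

text \<open>Two demands shape the estimates. The boundary values are unrestricted limits within G
  and within G^-, so control along the normal alone would not do: the base point of the subtraction
  has to move with \<open>z\<close>. And S^- asks for \<open>h\<close> in H, so the singular
  integral must be shown to preserve Hoelder continuity; as H admits every exponent in (0, 1], half
  of the exponent may be given away there.

  The operators are defined through \<open>Lim\<close>, which carries information only once the
  limit is known to exist, so principal values are proved as convergence statements.

  The value of the principal value of the winding integral is forced by arithmetic: two elements of
  {0, -2 pi i} whose difference is 2 pi i can only be 0 and -2 pi i, so it never matters on which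
  side of the curve its inside lies. The analytic function that witnesses membership in S^- is
  \<Phi> itself, considered on G^-.\<close>

lemma periodic2pi_add_int:
  assumes "periodic2pi f"
  shows "f (t + 2 * pi * of_int n) = f t"
proof -
  have nat: "f (t + 2 * pi * real n) = f t" for t and n :: nat
  proof (induction n)
    case (Suc n)
    have "f (t + 2 * pi * real (Suc n)) = f ((t + 2 * pi * real n) + 2 * pi)"
      by (simp add: algebra_simps)
    with Suc assms show ?case by (simp add: periodic2pi_def)
  qed simp
  show ?thesis
  proof (cases "n \<ge> 0")
    case True
    then show ?thesis using nat[of t "nat n"] by simp
  next
    case False
    then show ?thesis using nat[of "t + 2 * pi * of_int n" "nat (- n)"] by simp
  qed
qed

lemma reduce_mod_2pi:
  obtains n :: int where "t + 2 * pi * of_int n \<in> {0..<2 * pi}"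
proof
  have "t / (2 * pi) - of_int \<lfloor>t / (2 * pi)\<rfloor> \<ge> 0" "t / (2 * pi) - of_int \<lfloor>t / (2 * pi)\<rfloor> < 1"
    by linarith+
  then have "0 \<le> (t / (2 * pi) - of_int \<lfloor>t / (2 * pi)\<rfloor>) * (2 * pi)"
    "(t / (2 * pi) - of_int \<lfloor>t / (2 * pi)\<rfloor>) * (2 * pi) < 1 * (2 * pi)"
    by (auto intro!: mult_strict_right_mono)
  then show "t + 2 * pi * of_int (- \<lfloor>t / (2 * pi)\<rfloor>) \<in> {0..<2 * pi}"
    by (simp add: left_diff_distrib) (simp add: mult.commute)
qed

lemma periodic2pi_bounded:
  fixes f :: "real \<Rightarrow> complex"
  assumes "periodic2pi f" "continuous_on UNIV f"
  obtains B where "B > 0" "\<And>t. norm (f t) \<le> B"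
proof -
  have "compact (f ` {0..2 * pi})"
    by (intro compact_continuous_image continuous_on_subset[OF assms(2)]) auto
  then obtain B where B: "B > 0" "\<And>x. x \<in> f ` {0..2 * pi} \<Longrightarrow> norm x \<le> B"
    using compact_imp_bounded by (meson bounded_pos)
  have "norm (f t) \<le> B" for t
  proof -
    obtain n :: int where "t + 2 * pi * of_int n \<in> {0..<2 * pi}" by (rule reduce_mod_2pi)
    then have "f (t + 2 * pi * of_int n) \<in> f ` {0..2 * pi}" by (intro imageI) simp
    then show ?thesis using B(2) periodic2pi_add_int[OF assms(1), of t n] by metis
  qed
  with B that show ?thesis by blast
qed

lemma periodic2pi_bounded_below:
  fixes f :: "real \<Rightarrow> complex"
  assumes "periodic2pi f" "continuous_on UNIV f" "\<And>t. f t \<noteq> 0"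
  obtains b where "b > 0" "\<And>t. norm (f t) \<ge> b"
proof -
  have "periodic2pi (\<lambda>t. inverse (f t))"
    using assms(1) by (simp add: periodic2pi_def)
  moreover have "continuous_on UNIV (\<lambda>t. inverse (f t))"
    by (intro continuous_intros assms) (simp add: assms)
  ultimately obtain B where B: "B > 0" "\<And>t. norm (inverse (f t)) \<le> B"
    using periodic2pi_bounded by metis
  have "norm (f t) \<ge> inverse B" for t
    using B(2)[of t] B(1) assms(3)[of t]
    by (simp add: norm_divide field_simps)
  with B(1) that[of "inverse B"] show ?thesis by simp
qed

lemma has_vector_derivative_shift:
  fixes f :: "real \<Rightarrow> 'a :: real_normed_vector"
  assumes "(f has_vector_derivative D) (at (t + c))"
  shows "((\<lambda>x. f (x + c)) has_vector_derivative D) (at t)"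
proof -
  have "((\<lambda>x. x + c) has_vector_derivative 1) (at t)"
    by (auto intro!: derivative_eq_intros)
  from vector_diff_chain_at[OF this assms] show ?thesis by (simp add: o_def)
qed

lemma periodic2pi_vector_derivative:
  assumes "periodic2pi f" "\<And>t. (f has_vector_derivative f' t) (at t)"
  shows "periodic2pi f'"
  unfolding periodic2pi_def
proof
  fix t
  have "((\<lambda>x. f (x + 2 * pi)) has_vector_derivative f' (t + 2 * pi)) (at t)"
    by (intro has_vector_derivative_shift assms)
  then have "(f has_vector_derivative f' (t + 2 * pi)) (at t)"
    using assms(1) by (simp add: periodic2pi_def)
  then show "f' (t + 2 * pi) = f' t"
    using assms(2) vector_derivative_unique_at by blast
qed

text \<open>As a function of \<open>a\<close>, the window integral
  \<open>F (a + 2 * pi) - F a\<close> has derivative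
  \<open>f (a + 2 * pi) - f a = 0\<close>.\<close>

lemma integral_periodic_window:
  fixes f :: "real \<Rightarrow> complex"
  assumes "periodic2pi f" "continuous_on UNIV f"
  shows "integral {a..a + 2 * pi} f = integral {0..2 * pi} f"
proof -
  \<comment> \<open>The antiderivative lives on a compact interval; \<open>L\<close> is so large
    that \<open>x\<close> and \<open>x + 2 * pi\<close> are interior points whenever |x| is at most
    |a|.\<close>
  define L where "L = \<bar>a\<bar> + 2 * pi + 1"
  have L: "L > 0" by (simp add: L_def add_nonneg_pos)
  obtain F where F: "\<And>x. x \<in> {-L..L} \<Longrightarrow> (F has_vector_derivative f x) (at x within {-L..L})"
    using antiderivative_continuous[of "-L" L f] continuous_on_subset[OF assms(2)] by blast
  have eq: "integral {b..b + 2 * pi} f = F (b + 2 * pi) - F b" if "\<bar>b\<bar> \<le> \<bar>a\<bar>" for b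
  proof (intro integral_unique fundamental_theorem_of_calculus)
    show "(F has_vector_derivative f x) (at x within {b..b + 2 * pi})"
      if "x \<in> {b..b + 2 * pi}" for x
    proof (rule has_vector_derivative_within_subset[OF F])
      show "x \<in> {-L..L}" "{b..b + 2 * pi} \<subseteq> {-L..L}"
        using that \<open>\<bar>b\<bar> \<le> \<bar>a\<bar>\<close> pi_gt_zero unfolding L_def atLeastAtMost_iff subset_iff by linarith+
    qed
  qed simp
  have "((\<lambda>x. F (x + 2 * pi) - F x) has_derivative (\<lambda>_. 0)) (at x within {-\<bar>a\<bar>..\<bar>a\<bar>})"
    if "x \<in> {-\<bar>a\<bar>..\<bar>a\<bar>}" for x
  proof -
    have F': "(F has_vector_derivative f y) (at y)" if "\<bar>y\<bar> < L" for y
    proof -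
      have "-L < y" "y < L" using that by linarith+
      with F[of y] show ?thesis by (simp add: at_within_Icc_at)
    qed
    have "\<bar>x + 2 * pi\<bar> < L" "\<bar>x\<bar> < L"
      using that pi_gt_zero unfolding L_def atLeastAtMost_iff by linarith+
    then have "((\<lambda>x. F (x + 2 * pi) - F x) has_vector_derivative (f (x + 2 * pi) - f x)) (at x)"
      by (intro has_vector_derivative_diff has_vector_derivative_shift F')
    then have "((\<lambda>x. F (x + 2 * pi) - F x) has_vector_derivative 0) (at x)"
      using assms(1) by (simp add: periodic2pi_def)
    then show ?thesis
      by (simp add: has_vector_derivative_def has_derivative_at_withinI)
  qed
  then have "F (a + 2 * pi) - F a = F (0 + 2 * pi) - F 0"
    by (intro has_derivative_zero_unique[of "{-\<bar>a\<bar>..\<bar>a\<bar>}" "\<lambda>x. F (x + 2 * pi) - F x" a 0]) auto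
  with eq[of a] eq[of 0] show ?thesis by simp
qed

text \<open>The estimate is imposed on the whole line, so that windows centred at an arbitrary
  parameter can be used, but only for pairs at most one period apart: for bounded distances an
  exponent can be lowered, which makes the class closed under sums and products.\<close>

definition hoelder2pi :: "(real \<Rightarrow> complex) \<Rightarrow> bool" where
  "hoelder2pi f \<longleftrightarrow> periodic2pi f \<and> (\<exists>C \<alpha>. 0 < \<alpha> \<and> \<alpha> \<le> 1 \<and> 0 \<le> C \<and>
     (\<forall>s t. \<bar>s - t\<bar> \<le> 2 * pi \<longrightarrow> norm (f s - f t) \<le> C * \<bar>s - t\<bar> powr \<alpha>))"

text \<open>Lowers a Hoelder exponent from \<alpha> to \<beta>; the surplus power is absorbed by the
  bound \<open>D\<close> on the distance.\<close>

lemma powr_le_powr_bounded: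
  assumes "0 \<le> x" "x \<le> D" "0 < \<beta>" "\<beta> \<le> \<alpha>"
  shows "x powr \<alpha> \<le> D powr (\<alpha> - \<beta>) * (x::real) powr \<beta>"
proof -
  have "x powr \<alpha> = x powr (\<alpha> - \<beta>) * x powr \<beta>" by (simp flip: powr_add)
  also have "\<dots> \<le> D powr (\<alpha> - \<beta>) * x powr \<beta>"
    using assms by (intro mult_right_mono powr_mono2) auto
  finally show ?thesis .
qed

lemma hoelder2piI:
  assumes "periodic2pi f" "0 < \<alpha>" "\<alpha> \<le> 1"
    "\<And>s t. \<bar>s - t\<bar> \<le> 2 * pi \<Longrightarrow> norm (f s - f t) \<le> C * \<bar>s - t\<bar> powr \<alpha>"
  shows "hoelder2pi f"
proof -
  \<comment> \<open>At the pair \<open>1\<close>, \<open>0\<close> the power equals 1, so there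
    \<open>C\<close> dominates a norm.\<close>
  have "0 \<le> C"
    using order_trans[OF norm_ge_zero assms(4)[of 1 0]] pi_gt3 by simp
  with assms show ?thesis unfolding hoelder2pi_def by blast
qed

lemma hoelder2pi_continuous:
  assumes "hoelder2pi f" shows "continuous_on S f"
proof -
  obtain C \<alpha> where C: "0 < \<alpha>" "0 \<le> C"
    "\<And>s t. \<bar>s - t\<bar> \<le> 2 * pi \<Longrightarrow> norm (f s - f t) \<le> C * \<bar>s - t\<bar> powr \<alpha>"
    using assms unfolding hoelder2pi_def by blast
  have "isCont f t" for t
    unfolding isCont_def
  proof (subst Lim_null, rule Lim_null_comparison)
    show "\<forall>\<^sub>F s in at t. norm (f s - f t) \<le> C * \<bar>s - t\<bar> powr \<alpha>"
      unfolding eventually_at using C pi_gt_zero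
      by (intro exI[of _ "2 * pi"]) (auto simp: dist_real_def)
    have "((\<lambda>s. C * \<bar>s - t\<bar> powr \<alpha>) \<longlongrightarrow> C * \<bar>t - t\<bar> powr \<alpha>) (at t)"
      by (intro tendsto_intros) (use C in auto)
    then show "((\<lambda>s. C * \<bar>s - t\<bar> powr \<alpha>) \<longlongrightarrow> 0) (at t)" using C by simp
  qed
  then show ?thesis by (simp add: continuous_at_imp_continuous_on)
qed

lemma hoelder2pi_bounded:
  assumes "hoelder2pi f"
  obtains B where "B > 0" "\<And>t. norm (f t) \<le> B"
  using assms hoelder2pi_continuous[OF assms, of UNIV] periodic2pi_bounded
  unfolding hoelder2pi_def by metis

text \<open>Both functions are brought to the smaller of the two exponents; sums and products are
  estimated with a single power of |s - t|.\<close>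

lemma hoelder2pi_common_exponent:
  assumes "hoelder2pi f" "hoelder2pi g"
  obtains C \<alpha> where "0 < \<alpha>" "\<alpha> \<le> 1" "0 \<le> C"
    "\<And>s t. \<bar>s - t\<bar> \<le> 2 * pi \<Longrightarrow> norm (f s - f t) \<le> C * \<bar>s - t\<bar> powr \<alpha>"
    "\<And>s t. \<bar>s - t\<bar> \<le> 2 * pi \<Longrightarrow> norm (g s - g t) \<le> C * \<bar>s - t\<bar> powr \<alpha>"
proof -
  obtain C \<alpha> where f: "0 < \<alpha>" "\<alpha> \<le> 1" "0 \<le> C"
    "\<And>s t. \<bar>s - t\<bar> \<le> 2 * pi \<Longrightarrow> norm (f s - f t) \<le> C * \<bar>s - t\<bar> powr \<alpha>"
    using assms(1) unfolding hoelder2pi_def by blast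
  obtain D \<beta> where g: "0 < \<beta>" "\<beta> \<le> 1" "0 \<le> D"
    "\<And>s t. \<bar>s - t\<bar> \<le> 2 * pi \<Longrightarrow> norm (g s - g t) \<le> D * \<bar>s - t\<bar> powr \<beta>"
    using assms(2) unfolding hoelder2pi_def by blast
  define \<theta> where "\<theta> = min \<alpha> \<beta>"
  define E where "E = C * (2 * pi) powr (\<alpha> - \<theta>) + D * (2 * pi) powr (\<beta> - \<theta>)"
  have \<theta>: "0 < \<theta>" "\<theta> \<le> 1" "\<theta> \<le> \<alpha>" "\<theta> \<le> \<beta>" using f g by (auto simp: \<theta>_def)
  have le: "K * x powr \<kappa> \<le> K * (2 * pi) powr (\<kappa> - \<theta>) * x powr \<theta>"
    if "0 \<le> K" "\<theta> \<le> \<kappa>" "0 \<le> x" "x \<le> 2 * pi" for K \<kappa> x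
    using mult_left_mono[OF powr_le_powr_bounded[of x "2 * pi" \<theta> \<kappa>] that(1)] that \<theta>
    by (simp add: mult.assoc)
  have E: "C * (2 * pi) powr (\<alpha> - \<theta>) \<le> E" "D * (2 * pi) powr (\<beta> - \<theta>) \<le> E" "0 \<le> E"
    using f g by (auto simp: E_def)
  show ?thesis
  proof (rule that[OF \<theta>(1,2) E(3)])
    fix s t :: real assume st: "\<bar>s - t\<bar> \<le> 2 * pi"
    show "norm (f s - f t) \<le> E * \<bar>s - t\<bar> powr \<theta>"
      using f(4)[OF st] le[OF f(3) \<theta>(3) abs_ge_zero st] mult_right_mono[OF E(1), of "\<bar>s - t\<bar> powr \<theta>"]
      by simp
    show "norm (g s - g t) \<le> E * \<bar>s - t\<bar> powr \<theta>"
      using g(4)[OF st] le[OF g(3) \<theta>(4) abs_ge_zero st] mult_right_mono[OF E(2), of "\<bar>s - t\<bar> powr \<theta>"]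
      by simp
  qed
qed

lemma hoelder2pi_add:
  assumes "hoelder2pi f" "hoelder2pi g"
  shows "hoelder2pi (\<lambda>t. f t + g t)"
proof -
  obtain C \<alpha> where C: "0 < \<alpha>" "\<alpha> \<le> 1" "0 \<le> C"
    "\<And>s t. \<bar>s - t\<bar> \<le> 2 * pi \<Longrightarrow> norm (f s - f t) \<le> C * \<bar>s - t\<bar> powr \<alpha>"
    "\<And>s t. \<bar>s - t\<bar> \<le> 2 * pi \<Longrightarrow> norm (g s - g t) \<le> C * \<bar>s - t\<bar> powr \<alpha>"
    using hoelder2pi_common_exponent[OF assms] by metis
  show ?thesis
  proof (rule hoelder2piI[OF _ C(1,2), of _ "C + C"])
    show "periodic2pi (\<lambda>t. f t + g t)"
      using assms by (simp add: hoelder2pi_def periodic2pi_def)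
    show "norm (f s + g s - (f t + g t)) \<le> (C + C) * \<bar>s - t\<bar> powr \<alpha>"
      if "\<bar>s - t\<bar> \<le> 2 * pi" for s t
      using norm_diff_triangle_ineq[of "f s" "g s" "f t" "g t"] C(4,5)[OF that]
      by (simp add: algebra_simps)
  qed
qed

lemma hoelder2pi_mult:
  assumes "hoelder2pi f" "hoelder2pi g"
  shows "hoelder2pi (\<lambda>t. f t * g t)"
proof -
  obtain C \<alpha> where C: "0 < \<alpha>" "\<alpha> \<le> 1" "0 \<le> C"
    "\<And>s t. \<bar>s - t\<bar> \<le> 2 * pi \<Longrightarrow> norm (f s - f t) \<le> C * \<bar>s - t\<bar> powr \<alpha>"
    "\<And>s t. \<bar>s - t\<bar> \<le> 2 * pi \<Longrightarrow> norm (g s - g t) \<le> C * \<bar>s - t\<bar> powr \<alpha>"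
    using hoelder2pi_common_exponent[OF assms] by metis
  obtain F where F: "F > 0" "\<And>t. norm (f t) \<le> F" using hoelder2pi_bounded[OF assms(1)] by metis
  obtain G where G: "G > 0" "\<And>t. norm (g t) \<le> G" using hoelder2pi_bounded[OF assms(2)] by metis
  show ?thesis
  proof (rule hoelder2piI[OF _ C(1,2), of _ "F * C + C * G"])
    show "periodic2pi (\<lambda>t. f t * g t)"
      using assms by (simp add: hoelder2pi_def periodic2pi_def)
    fix s t :: real assume st: "\<bar>s - t\<bar> \<le> 2 * pi"
    have "norm (f s * g s - f t * g t) = norm (f s * (g s - g t) + (f s - f t) * g t)"
      by (simp add: algebra_simps)
    also have "\<dots> \<le> norm (f s) * norm (g s - g t) + norm (f s - f t) * norm (g t)"
      by (metis norm_mult norm_triangle_ineq)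
    also have "\<dots> \<le> F * (C * \<bar>s - t\<bar> powr \<alpha>) + (C * \<bar>s - t\<bar> powr \<alpha>) * G"
      using F G C st by (intro add_mono mult_mono) auto
    finally show "norm (f s * g s - f t * g t) \<le> (F * C + C * G) * \<bar>s - t\<bar> powr \<alpha>"
      by (simp add: algebra_simps)
  qed
qed

lemma hoelder2pi_const: "hoelder2pi (\<lambda>_. c)"
  by (rule hoelder2piI[of _ 1 0]) (auto simp: periodic2pi_def)

lemma hoelder2pi_sum:
  assumes "\<And>k. k \<in> K \<Longrightarrow> hoelder2pi (f k)"
  shows "hoelder2pi (\<lambda>t. \<Sum>k\<in>K. f k t)"
  using assms by (induction K rule: infinite_finite_induct) (auto intro: hoelder2pi_const hoelder2pi_add)

lemma norm_diff_le_deriv_bound: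
  fixes f :: "real \<Rightarrow> complex"
  assumes "\<And>t. (f has_vector_derivative f' t) (at t)" "\<And>t. norm (f' t) \<le> B"
  shows "norm (f s - f t) \<le> B * \<bar>s - t\<bar>"
proof -
  have "norm (f s - f t) \<le> B * norm (s - t)"
  proof (rule differentiable_bound[of UNIV])
    show "(f has_derivative (\<lambda>h. h *\<^sub>R f' x)) (at x within UNIV)" for x
      using assms(1)[of x] by (simp add: has_vector_derivative_def)
    show "onorm (\<lambda>h. h *\<^sub>R f' x) \<le> B" for x
      using assms(2)[of x] by (intro onorm_le) (simp add: mult_left_mono mult.commute[of B])
  qed auto
  then show ?thesis by simp
qed

lemma C1_periodic_hoelder2pi:
  assumes "periodic2pi f" "C1_fun f"
  shows "hoelder2pi f"
proof -
  obtain f' where f': "\<And>t. (f has_vector_derivative f' t) (at t)" "continuous_on UNIV f'"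
    using assms(2) unfolding C1_fun_def by blast
  obtain B where B: "\<And>t. norm (f' t) \<le> B"
    using periodic2pi_bounded[OF periodic2pi_vector_derivative[OF assms(1) f'(1)] f'(2)] by metis
  show ?thesis
    using norm_diff_le_deriv_bound[OF f'(1) B]
    by (intro hoelder2piI[OF assms(1), of 1 B]) auto
qed

lemma hoelder2pi_inverse:
  assumes "hoelder2pi f" "\<And>t. f t \<noteq> 0"
  shows "hoelder2pi (\<lambda>t. inverse (f t))"
proof -
  obtain C \<alpha> where C: "0 < \<alpha>" "\<alpha> \<le> 1" "0 \<le> C"
    "\<And>s t. \<bar>s - t\<bar> \<le> 2 * pi \<Longrightarrow> norm (f s - f t) \<le> C * \<bar>s - t\<bar> powr \<alpha>"
    and per: "periodic2pi f"
    using assms unfolding hoelder2pi_def by blast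
  obtain b where b: "b > 0" "\<And>t. norm (f t) \<ge> b"
    using periodic2pi_bounded_below[OF per hoelder2pi_continuous[OF assms(1)] assms(2)] by metis
  show ?thesis
  proof (rule hoelder2piI[OF _ C(1,2), of _ "C / (b * b)"])
    show "periodic2pi (\<lambda>t. inverse (f t))" using per by (simp add: periodic2pi_def)
    fix s t :: real assume st: "\<bar>s - t\<bar> \<le> 2 * pi"
    have "inverse (f s) - inverse (f t) = (f t - f s) / (f s * f t)"
      using assms(2) by (simp add: field_simps)
    then have "norm (inverse (f s) - inverse (f t)) = norm (f s - f t) / (norm (f s) * norm (f t))"
      by (simp add: norm_divide norm_mult norm_minus_commute)
    also have "\<dots> \<le> (C * \<bar>s - t\<bar> powr \<alpha>) / (b * b)"
      using C st b by (intro frac_le mult_mono) auto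
    finally show "norm (inverse (f s) - inverse (f t)) \<le> C / (b * b) * \<bar>s - t\<bar> powr \<alpha>"
      by simp
  qed
qed

text \<open>Membership in H controls only pairs inside [0, 2 pi]. A common shift moves the smaller
  parameter there without changing the distance. If the larger one then lies beyond 2 pi, the pair
  is split at 2 pi, which periodicity identifies with 0; both pieces are no longer than the whole,
  hence the doubled constant.\<close>

lemma hoelder2pi_of_real:
  assumes "periodic2pi u" "holder_on {0..2 * pi} u"
  shows "hoelder2pi (\<lambda>t. complex_of_real (u t))"
proof -
  obtain C \<alpha> where C: "0 < \<alpha>" "\<alpha> \<le> 1"
    and le: "\<And>s t. s \<in> {0..2 * pi} \<Longrightarrow> t \<in> {0..2 * pi} \<Longrightarrow> \<bar>u s - u t\<bar> \<le> C * \<bar>s - t\<bar> powr \<alpha>"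
    using assms(2) unfolding holder_on_def by blast
  have "0 \<le> C" using order_trans[OF abs_ge_zero le[of 1 0]] pi_gt3 by simp
  have main: "\<bar>u s - u t\<bar> \<le> (C + C) * \<bar>s - t\<bar> powr \<alpha>"
    if "s \<le> t" "t - s \<le> 2 * pi" for s t
  proof -
    obtain n :: int where n: "s + 2 * pi * of_int n \<in> {0..<2 * pi}" by (rule reduce_mod_2pi)
    define x y where "x = s + 2 * pi * of_int n" and "y = t + 2 * pi * of_int n"
    have xy: "u x = u s" "u y = u t" "t - s = y - x" "x \<le> y" "y - x \<le> 2 * pi" "0 \<le> x" "x \<le> 2 * pi"
      using periodic2pi_add_int[OF assms(1)] n that by (auto simp: x_def y_def)
    have "\<bar>u x - u y\<bar> \<le> (C + C) * (y - x) powr \<alpha>"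
    proof (cases "y \<le> 2 * pi")
      case True
      have "C * (y - x) powr \<alpha> \<le> (C + C) * (y - x) powr \<alpha>"
        using \<open>0 \<le> C\<close> by (intro mult_right_mono) auto
      then show ?thesis using le[of x y] xy True by (simp add: abs_minus_commute)
    next
      case False
      define y' where "y' = y - 2 * pi"
      have y': "u y' = u y" using assms(1) unfolding periodic2pi_def y'_def by (metis diff_add_cancel)
      have "u 0 = u (2 * pi)" using assms(1) unfolding periodic2pi_def by (metis add_0)
      then have "\<bar>u x - u y\<bar> \<le> \<bar>u x - u (2 * pi)\<bar> + \<bar>u y' - u 0\<bar>" using y' by linarith
      also have "\<dots> \<le> C * \<bar>x - 2 * pi\<bar> powr \<alpha> + C * \<bar>y' - 0\<bar> powr \<alpha>"
        using xy False by (intro add_mono le) (auto simp: y'_def)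
      also have "\<dots> \<le> C * (y - x) powr \<alpha> + C * (y - x) powr \<alpha>"
        using xy False \<open>0 \<le> C\<close> C by (intro add_mono mult_left_mono powr_mono2) (auto simp: y'_def)
      finally show ?thesis by (simp add: algebra_simps)
    qed
    then show ?thesis using xy by (simp add: abs_minus_commute)
  qed
  show ?thesis
  proof (rule hoelder2piI[OF _ C, of _ "C + C"])
    show "periodic2pi (\<lambda>t. complex_of_real (u t))" using assms(1) by (simp add: periodic2pi_def)
    fix s t :: real assume st: "\<bar>s - t\<bar> \<le> 2 * pi"
    have "\<bar>u s - u t\<bar> \<le> (C + C) * \<bar>s - t\<bar> powr \<alpha>"
    proof (cases "s \<le> t")
      case True
      then show ?thesis using main[of s t] st by simp
    next
      case False
      then show ?thesis using main[of t s] st by (simp add: abs_minus_commute)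
    qed
    then show "cmod (complex_of_real (u s) - complex_of_real (u t)) \<le> (C + C) * \<bar>s - t\<bar> powr \<alpha>"
      by (metis norm_of_real of_real_diff)
  qed
qed

lemma hoelder2pi_imp_holder_on:
  assumes "hoelder2pi (\<lambda>t. complex_of_real (u t))"
  shows "periodic2pi u" "holder_on {0..2 * pi} u"
proof -
  show "periodic2pi u" using assms by (simp add: hoelder2pi_def periodic2pi_def)
  obtain C \<alpha> where C: "0 < \<alpha>" "\<alpha> \<le> 1"
    "\<And>s t. \<bar>s - t\<bar> \<le> 2 * pi \<Longrightarrow> norm (complex_of_real (u s) - complex_of_real (u t)) \<le> C * \<bar>s - t\<bar> powr \<alpha>"
    using assms unfolding hoelder2pi_def by blast
  have "\<bar>u s - u t\<bar> \<le> C * \<bar>s - t\<bar> powr \<alpha>" if "s \<in> {0..2 * pi}" "t \<in> {0..2 * pi}" for s t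
  proof -
    have "\<bar>s - t\<bar> \<le> 2 * pi" using that unfolding atLeastAtMost_iff by linarith
    then show ?thesis using C(3)[of s t] by (metis norm_of_real of_real_diff)
  qed
  then show "holder_on {0..2 * pi} u" unfolding holder_on_def using C(1,2) by blast
qed

subsection \<open>A single loop\<close>

text \<open>One boundary component, studied without reference to \<open>A\<close> or to the other
  curves; the system of curves instantiates it for each index.\<close>

locale C2_loop =
  fixes \<eta> :: "real \<Rightarrow> complex"
  assumes periodic: "periodic2pi \<eta>"
    and C2: "C2_fun \<eta>"
    and deriv_nonzero: "vector_derivative \<eta> (at t) \<noteq> 0"
    and simple: "simple_path (\<lambda>x. \<eta> (2 * pi * x))"
    and clockwise: "z \<in> inside (path_image (\<lambda>x. \<eta> (2 * pi * x))) \<Longrightarrow>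
      winding_number (\<lambda>x. \<eta> (2 * pi * x)) z = -1"
begin

definition \<eta>' :: "real \<Rightarrow> complex" where
  "\<eta>' t = vector_derivative \<eta> (at t)"

lemma C2_cases:
  obtains \<eta>2 where "\<And>t. (\<eta> has_vector_derivative \<eta>' t) (at t)"
    "\<And>t. (\<eta>' has_vector_derivative \<eta>2 t) (at t)" "continuous_on UNIV \<eta>2"
proof -
  obtain f1 f2 where f: "\<And>t. (\<eta> has_vector_derivative f1 t) (at t)"
    "\<And>t. (f1 has_vector_derivative f2 t) (at t)" "continuous_on UNIV f2"
    using C2 unfolding C2_fun_def by blast
  have "\<eta>' = f1" unfolding \<eta>'_def using vector_derivative_at[OF f(1)] by blast
  with f that show ?thesis by metis
qed

lemma has_deriv: "(\<eta> has_vector_derivative \<eta>' t) (at t)"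
  using C2_cases by metis

lemma continuous_eta': "continuous_on S \<eta>'"
  using C2_cases by (metis continuous_at_imp_continuous_on has_vector_derivative_continuous)

lemma continuous_eta: "continuous_on S \<eta>"
  using has_deriv by (metis continuous_at_imp_continuous_on has_vector_derivative_continuous)

lemma periodic': "periodic2pi \<eta>'"
  by (rule periodic2pi_vector_derivative[OF periodic has_deriv])

lemma eta'_nonzero: "\<eta>' t \<noteq> 0"
  using deriv_nonzero by (simp add: \<eta>'_def)

text \<open>The bounded second derivative enters here, to make \<open>\<eta>'\<close> Lipschitz. A
  single constant serves for size and Lipschitz bound.\<close>

lemma deriv_bounds:
  obtains L where "L > 0" "\<And>t. norm (\<eta>' t) \<le> L"
    "\<And>s t. norm (\<eta>' s - \<eta>' t) \<le> L * \<bar>s - t\<bar>"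
proof -
  obtain \<eta>2 where e: "\<And>t. (\<eta>' has_vector_derivative \<eta>2 t) (at t)" "continuous_on UNIV \<eta>2"
    using C2_cases by metis
  obtain B1 where B1: "B1 > 0" "\<And>t. norm (\<eta>' t) \<le> B1"
    using periodic2pi_bounded[OF periodic' continuous_eta'] by metis
  obtain B2 where B2: "B2 > 0" "\<And>t. norm (\<eta>2 t) \<le> B2"
    using periodic2pi_bounded[OF periodic2pi_vector_derivative[OF periodic' e(1)] e(2)] by metis
  have "norm (\<eta>' t) \<le> B1 + B2" "norm (\<eta>2 t) \<le> B1 + B2" for t
    using B1(2)[of t] B2(2)[of t] B1(1) B2(1) by linarith+
  with that[of "B1 + B2"] B1(1) B2(1) norm_diff_le_deriv_bound[OF e(1), of "B1 + B2"] show ?thesis by simp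
qed

lemma path_image_eq: "path_image (\<lambda>x. \<eta> (2 * pi * x)) = range \<eta>"
proof
  show "path_image (\<lambda>x. \<eta> (2 * pi * x)) \<subseteq> range \<eta>" by (auto simp: path_image_def)
  show "range \<eta> \<subseteq> path_image (\<lambda>x. \<eta> (2 * pi * x))"
  proof clarify
    fix t
    obtain n :: int where n: "t + 2 * pi * of_int n \<in> {0..<2 * pi}" by (rule reduce_mod_2pi)
    define x where "x = (t + 2 * pi * of_int n) / (2 * pi)"
    have "x \<in> {0..1}" "\<eta> t = \<eta> (2 * pi * x)"
      using n periodic2pi_add_int[OF periodic, of t n] by (auto simp: x_def divide_le_eq_1)
    then show "\<eta> t \<in> path_image (\<lambda>x. \<eta> (2 * pi * x))" unfolding path_image_def by blast
  qed
qed

text \<open>After reduction of both parameters to one period, simplicity shows that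
  \<open>s - t\<close> is a multiple of 2 pi, and 0 is the only one of modulus below 2 pi.\<close>

lemma eta_inj:
  assumes "\<eta> s = \<eta> t" "\<bar>s - t\<bar> < 2 * pi"
  shows "s = t"
proof -
  have inj0: "x = y" if "x \<in> {0..<2 * pi}" "y \<in> {0..<2 * pi}" "\<eta> x = \<eta> y" for x y
  proof -
    have "x / (2 * pi) \<in> {0..<1}" "y / (2 * pi) \<in> {0..<1}" using that by auto
    moreover have "\<eta> (2 * pi * (x / (2 * pi))) = \<eta> (2 * pi * (y / (2 * pi)))" using that by simp
    ultimately have "x / (2 * pi) = y / (2 * pi)"
      using simple unfolding simple_path_def loop_free_def
      by (smt (verit) atLeastAtMost_iff atLeastLessThan_iff)
    then show ?thesis by simp
  qed
  obtain n :: int where n: "s + 2 * pi * of_int n \<in> {0..<2 * pi}" by (rule reduce_mod_2pi)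
  obtain m :: int where m: "t + 2 * pi * of_int m \<in> {0..<2 * pi}" by (rule reduce_mod_2pi)
  have eq: "s + 2 * pi * of_int n = t + 2 * pi * of_int m"
    using inj0[OF n m] assms periodic2pi_add_int[OF periodic] by simp
  then have "s - t = 2 * pi * of_int (m - n)" by (simp add: algebra_simps)
  then have "\<bar>2 * pi * real_of_int (m - n)\<bar> < 2 * pi" using assms(2) by simp
  then have "2 * pi * \<bar>real_of_int (m - n)\<bar> < 2 * pi * 1" by (simp add: abs_mult)
  then have "\<bar>real_of_int (m - n)\<bar> < 1" by (simp add: mult_less_cancel_left_pos)
  then have "m = n" by linarith
  with eq show ?thesis by simp
qed

text \<open>The point is uniformity in \<open>s\<close>: the remainder is governed by the Lipschitz
  constant of \<open>\<eta>'\<close>, which is global.\<close>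

lemma linearization:
  obtains L where "L > 0" "\<And>s x. norm (\<eta> (s + x) - \<eta> s - x *\<^sub>R \<eta>' s) \<le> \<bar>x\<bar> * (L * \<bar>x\<bar>)"
proof -
  obtain L where L: "L > 0" "\<And>s t. norm (\<eta>' s - \<eta>' t) \<le> L * \<bar>s - t\<bar>"
    using deriv_bounds by metis
  have "norm (\<eta> (s + x) - \<eta> s - ((s + x) - s) *\<^sub>R \<eta>' s) \<le> norm ((s + x) - s) * (L * \<bar>x\<bar>)" for s x
  proof (rule vector_differentiable_bound_linearization)
    show "(\<eta> has_vector_derivative \<eta>' y) (at y within closed_segment s (s + x))" for y
      by (rule has_vector_derivative_at_within[OF has_deriv])
    show "norm (\<eta>' y - \<eta>' s) \<le> L * \<bar>x\<bar>" if "y \<in> closed_segment s (s + x)" for y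
    proof -
      have "\<bar>y - s\<bar> \<le> \<bar>x\<bar>" using that by (auto simp: closed_segment_eq_real_ivl split: if_splits)
      then show ?thesis using L(2)[of y s] L(1) by (meson mult_left_mono less_imp_le order_trans)
    qed
  qed auto
  with L(1) that show ?thesis by simp
qed

text \<open>For small increments the linear term, bounded below because \<open>\<eta>'\<close> has
  no zero, dominates the remainder; for the remaining ones compactness and injectivity give a
  positive minimum.\<close>

lemma chord_arc:
  obtains c where "c > 0" "\<And>s t. \<bar>s - t\<bar> \<le> pi \<Longrightarrow> c * \<bar>s - t\<bar> \<le> norm (\<eta> s - \<eta> t)"
proof -
  obtain L where L: "L > 0" "\<And>s x. norm (\<eta> (s + x) - \<eta> s - x *\<^sub>R \<eta>' s) \<le> \<bar>x\<bar> * (L * \<bar>x\<bar>)"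
    using linearization by metis
  obtain b where b: "b > 0" "\<And>t. norm (\<eta>' t) \<ge> b"
    using periodic2pi_bounded_below[OF periodic' continuous_eta' eta'_nonzero] by metis
  \<comment> \<open>For |x| up to \<open>r\<close> the remainder \<open>L * |x|^2\<close> uses up at
    most half of the linear term \<open>b * |x|\<close>.\<close>
  define r where "r = min pi (b / (2 * L))"
  have r: "0 < r" "r \<le> pi" "r \<le> b / (2 * L)" using L(1) b(1) by (auto simp: r_def)
  have near: "b / 2 * \<bar>x\<bar> \<le> norm (\<eta> (s + x) - \<eta> s)" if "\<bar>x\<bar> \<le> r" for s x
  proof -
    have lin: "norm (\<eta> (s + x) - \<eta> s - x *\<^sub>R \<eta>' s) \<le> \<bar>x\<bar> * (L * \<bar>x\<bar>)" by (rule L(2))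
    have "L * \<bar>x\<bar> \<le> L * (b / (2 * L))" using that r L(1) by (intro mult_left_mono) auto
    then have "\<bar>x\<bar> * (L * \<bar>x\<bar>) \<le> \<bar>x\<bar> * (b / 2)"
      using L(1) by (intro mult_left_mono) auto
    moreover have "\<bar>x\<bar> * b \<le> norm (x *\<^sub>R \<eta>' s)" using b(2)[of s] by (simp add: mult_left_mono)
    moreover have "norm (x *\<^sub>R \<eta>' s) \<le> norm (\<eta> (s + x) - \<eta> s) + norm (\<eta> (s + x) - \<eta> s - x *\<^sub>R \<eta>' s)"
      using norm_triangle_sub[of "x *\<^sub>R \<eta>' s" "\<eta> (s + x) - \<eta> s"] by (simp add: norm_minus_commute)
    ultimately show ?thesis using lin by (simp add: algebra_simps)
  qed
  \<comment> \<open>Base points run over one period, increments over a compact set that avoids 0 and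
    stays below a full period, so \<open>eta_inj\<close> applies on all of \<open>K\<close>.\<close>
  define K where "K = {0..2 * pi} \<times> ({-pi..-r} \<union> {r..pi})"
  have "compact K" unfolding K_def by (intro compact_Times compact_Un) auto
  moreover have "K \<noteq> {}" using r pi_gt_zero by (auto simp: K_def)
  moreover have "continuous_on K (\<lambda>q. norm (\<eta> (fst q + snd q) - \<eta> (fst q)))"
  proof -
    have "continuous_on K (\<lambda>q. \<eta> (fst q + snd q))" "continuous_on K (\<lambda>q. \<eta> (fst q))"
      by (rule continuous_on_compose2[OF continuous_eta[of UNIV]]; auto intro!: continuous_intros)+
    then show ?thesis by (intro continuous_intros)
  qed
  ultimately obtain p where p: "p \<in> K"
    "\<forall>q\<in>K. norm (\<eta> (fst p + snd p) - \<eta> (fst p)) \<le> norm (\<eta> (fst q + snd q) - \<eta> (fst q))"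
    by (rule continuous_attains_inf[THEN bexE])
  define e where "e = norm (\<eta> (fst p + snd p) - \<eta> (fst p))"
  have "e > 0"
  proof -
    obtain s x where sx: "p = (s, x)" by (cases p)
    have "x \<noteq> 0" "\<bar>x\<bar> < 2 * pi" using p(1) r pi_gt_zero by (auto simp: K_def sx)
    then have "\<eta> (s + x) \<noteq> \<eta> s" using eta_inj[of "s + x" s] by auto
    then show ?thesis by (simp add: e_def sx)
  qed
  \<comment> \<open>Division by pi turns the constant lower bound \<open>e\<close> into a linear
    one, since |x| is at most pi.\<close>
  have far: "e / pi * \<bar>x\<bar> \<le> norm (\<eta> (s + x) - \<eta> s)" if "r \<le> \<bar>x\<bar>" "\<bar>x\<bar> \<le> pi" for s x
  proof -
    obtain n :: int where n: "s + 2 * pi * of_int n \<in> {0..<2 * pi}" by (rule reduce_mod_2pi)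
    have "(s + 2 * pi * of_int n, x) \<in> K" using n that by (auto simp: K_def abs_if split: if_splits)
    from p(2)[rule_format, OF this] have "e \<le> norm (\<eta> (s + 2 * pi * of_int n + x) - \<eta> (s + 2 * pi * of_int n))"
      by (simp add: e_def)
    also have "\<dots> = norm (\<eta> (s + x) - \<eta> s)"
      using periodic2pi_add_int[OF periodic, of s n] periodic2pi_add_int[OF periodic, of "s + x" n]
      by (simp add: algebra_simps)
    finally have "e \<le> norm (\<eta> (s + x) - \<eta> s)" .
    moreover have "e / pi * \<bar>x\<bar> \<le> e / pi * pi"
      using that \<open>e > 0\<close> by (intro mult_left_mono) auto
    ultimately show ?thesis by simp
  qed
  show ?thesis
  proof (rule that[of "min (b / 2) (e / pi)"])
    show "0 < min (b / 2) (e / pi)" using \<open>e > 0\<close> b(1) by simp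
    fix s t :: real assume st: "\<bar>s - t\<bar> \<le> pi"
    have "min (b / 2) (e / pi) * \<bar>s - t\<bar> \<le> b / 2 * \<bar>s - t\<bar>"
      by (rule mult_right_mono[OF min.cobounded1 abs_ge_zero])
    moreover have "min (b / 2) (e / pi) * \<bar>s - t\<bar> \<le> e / pi * \<bar>s - t\<bar>"
      by (rule mult_right_mono[OF min.cobounded2 abs_ge_zero])
    ultimately show "min (b / 2) (e / pi) * \<bar>s - t\<bar> \<le> norm (\<eta> s - \<eta> t)"
      using near[of "s - t" t] far[of "s - t" t] st by (cases "\<bar>s - t\<bar> \<le> r") auto
  qed
qed

section \<open>Winding numbers as integrals over the parameter\<close>

lemma winding_integral:
  assumes "z \<notin> range \<eta>"
  shows "integral {0..2 * pi} (\<lambda>t. \<eta>' t / (\<eta> t - z)) =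
    2 * pi * \<i> * winding_number (\<lambda>x. \<eta> (2 * pi * x)) z"
proof -
  define p where "p = (\<lambda>x. \<eta> (2 * pi * x))"
  have p': "(p has_vector_derivative (2 * pi) *\<^sub>R \<eta>' (2 * pi * x)) (at x)" for x
  proof -
    have "((\<lambda>x. 2 * pi * x) has_vector_derivative 2 * pi) (at x)"
      by (auto intro!: derivative_eq_intros simp: has_real_derivative_iff_has_vector_derivative[symmetric])
    from vector_diff_chain_at[OF this has_deriv] show ?thesis by (simp add: o_def p_def)
  qed
  have "continuous_on UNIV (\<lambda>x. (2 * pi) *\<^sub>R \<eta>' (2 * pi * x))"
    by (intro continuous_intros continuous_on_compose2[OF continuous_eta'[of UNIV]]) auto
  then have "p C1_differentiable_on {0..1}"
    unfolding C1_differentiable_on_def using p' continuous_on_subset[of UNIV _ "{0..1}"]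
    by (intro exI[of _ "\<lambda>x. (2 * pi) *\<^sub>R \<eta>' (2 * pi * x)"]) auto
  then have "valid_path p"
    unfolding valid_path_def by (rule C1_differentiable_imp_piecewise)
  then have "winding_number p z = 1 / (2 * pi * \<i>) * contour_integral p (\<lambda>w. 1 / (w - z))"
    using assms path_image_eq by (intro winding_number_valid_path) (auto simp: p_def)
  also have "contour_integral p (\<lambda>w. 1 / (w - z)) =
      integral {0..1} (\<lambda>x. 1 / (p x - z) * ((2 * pi) *\<^sub>R \<eta>' (2 * pi * x)))"
    by (simp add: contour_integral_integral vector_derivative_at[OF p'])
  also have "\<dots> = integral {0..1} (\<lambda>x. (2 * pi) *\<^sub>R (\<eta>' (2 * pi * x) / (\<eta> (2 * pi * x) - z)))"
    by (simp add: p_def)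
  also have "\<dots> = (2 * pi) *\<^sub>R integral {0..1} (\<lambda>x. \<eta>' (2 * pi * x) / (\<eta> (2 * pi * x) - z))"
    by (rule integral_cmul)
  also have "\<dots> = integral {0..2 * pi} (\<lambda>t. \<eta>' t / (\<eta> t - z))"
  proof -
    have im: "(\<lambda>x. x / (2 * pi)) ` {0..2 * pi} = {0..1}"
      using image_divide_atLeastAtMost[of "2 * pi" 0 "2 * pi"] by simp
    have "(\<lambda>t. \<eta>' t / (\<eta> t - z)) integrable_on {0..2 * pi}"
      using assms by (intro integrable_continuous_real continuous_intros continuous_eta continuous_eta') auto
    from has_integral_stretch_real[OF integrable_integral[OF this], of "2 * pi"]
    have "integral {0..1} (\<lambda>x. \<eta>' (2 * pi * x) / (\<eta> (2 * pi * x) - z)) =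
        (1 / (2 * pi)) *\<^sub>R integral {0..2 * pi} (\<lambda>t. \<eta>' t / (\<eta> t - z))"
      unfolding im by (simp add: integral_unique)
    then show ?thesis by simp
  qed
  finally show ?thesis by (simp add: p_def)
qed

lemma closed_range: "closed (range \<eta>)"
  using closed_path_image[OF simple_path_imp_path[OF simple]] by (simp add: path_image_eq)

lemma winding_outside:
  assumes "z \<in> outside (range \<eta>)"
  shows "integral {0..2 * pi} (\<lambda>t. \<eta>' t / (\<eta> t - z)) = 0"
proof -
  have "z \<notin> range \<eta>" using assms outside_no_overlap by blast
  moreover have "winding_number (\<lambda>x. \<eta> (2 * pi * x)) z = 0"
  proof (rule winding_number_zero_in_outside[OF simple_path_imp_path[OF simple]])
    show "pathfinish (\<lambda>x. \<eta> (2 * pi * x)) = pathstart (\<lambda>x. \<eta> (2 * pi * x))"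
      using periodic2pi_add_int[OF periodic, of 0 1] by (simp add: pathfinish_def pathstart_def)
  qed (use assms path_image_eq in simp)
  ultimately show ?thesis by (simp add: winding_integral)
qed

lemma winding_inside:
  assumes "z \<in> inside (range \<eta>)"
  shows "integral {0..2 * pi} (\<lambda>t. \<eta>' t / (\<eta> t - z)) = - (2 * pi * \<i>)"
proof -
  have "z \<notin> range \<eta>" using assms inside_no_overlap by blast
  then show ?thesis using clockwise[of z] assms by (simp add: winding_integral path_image_eq)
qed

end

subsection \<open>Boundary behaviour of the Cauchy integral\<close>

lemma integrable_abs_powr:
  assumes "a > (-1::real)"
  shows "(\<lambda>x. \<bar>x\<bar> powr a) integrable_on {-pi..pi}"
proof (rule Henstock_Kurzweil_Integration.integrable_combine[of _ 0])
  have "(\<lambda>x. x powr a) integrable_on {0..pi}" using assms by (intro integrable_on_powr_from_0) auto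
  then show pos: "(\<lambda>x. \<bar>x\<bar> powr a) integrable_on {0..pi}"
    by (rule integrable_eq) auto
  then show "(\<lambda>x. \<bar>x\<bar> powr a) integrable_on {-pi..0}"
    using Henstock_Kurzweil_Integration.integrable_reflect_real[where f = "\<lambda>x. \<bar>x\<bar> powr a" and a = 0 and b = pi] by simp
qed auto

text \<open>On the punctured interval the function is measurable by continuity and dominated by an
  integrable power; the missing point is a null set.\<close>

lemma integrable_weakly_singular:
  fixes f :: "real \<Rightarrow> complex"
  assumes "continuous_on ({-pi..pi} - {0}) f" "0 < \<alpha>"
    "\<And>x. x \<in> {-pi..pi} - {0} \<Longrightarrow> norm (f x) \<le> C * \<bar>x\<bar> powr (\<alpha> - 1)"
  shows "f integrable_on {-pi..pi}"
proof -
  have "(\<lambda>x. C * \<bar>x\<bar> powr (\<alpha> - 1)) integrable_on {-pi..pi}"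
    using assms(2) by (intro integrable_on_mult_right integrable_abs_powr) auto
  then have "(\<lambda>x. C * \<bar>x\<bar> powr (\<alpha> - 1)) integrable_on ({-pi..pi} - {0})"
    by (rule integrable_spike_set) (rule negligible_subset[OF negligible_sing[of 0]]; auto)+
  moreover have meas: "{-pi..pi} - {0} \<in> sets lebesgue" by simp
  moreover have "f \<in> borel_measurable (lebesgue_on ({-pi..pi} - {0}))"
    by (rule continuous_imp_measurable_on_sets_lebesgue[OF assms(1) meas])
  ultimately have "f integrable_on ({-pi..pi} - {0})"
    using assms(3) by (blast intro: measurable_bounded_by_integrable_imp_integrable)
  then show ?thesis
    by (rule integrable_spike_set) (rule negligible_subset[OF negligible_sing[of 0]]; auto)+
qed

context C2_loop
begin

definition nearest :: "real \<Rightarrow> complex \<Rightarrow> bool" where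
  "nearest s z \<longleftrightarrow> (\<forall>t. norm (\<eta> s - z) \<le> norm (\<eta> t - z))"

lemma nearest_self: "nearest s (\<eta> s)"
  by (simp add: nearest_def)

text \<open>One period around \<open>s0\<close> contains a global minimizer. This window is chosen
  because \<open>chord_arc\<close> compares only parameters at most pi apart, and in the jump
  relation \<open>s0\<close> is the parameter of the limit point.\<close>

lemma nearest_exists:
  obtains s where "\<bar>s - s0\<bar> \<le> pi" "nearest s z"
proof -
  have "compact {s0 - pi..s0 + pi}" "{s0 - pi..s0 + pi} \<noteq> {}" by auto
  moreover have "continuous_on {s0 - pi..s0 + pi} (\<lambda>s. norm (\<eta> s - z))"
    by (intro continuous_intros continuous_eta)
  ultimately obtain s where s: "s \<in> {s0 - pi..s0 + pi}"
    "\<forall>t\<in>{s0 - pi..s0 + pi}. norm (\<eta> s - z) \<le> norm (\<eta> t - z)"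
    by (rule continuous_attains_inf[THEN bexE])
  have "norm (\<eta> s - z) \<le> norm (\<eta> t - z)" for t
  proof -
    obtain n :: int where n: "t - s0 + pi + 2 * pi * of_int n \<in> {0..<2 * pi}" by (rule reduce_mod_2pi)
    have "t + 2 * pi * of_int n \<in> {s0 - pi..s0 + pi}" using n by auto
    from s(2)[rule_format, OF this] show ?thesis by (simp add: periodic2pi_add_int[OF periodic])
  qed
  moreover have "\<bar>s - s0\<bar> \<le> pi" using s(1) by (auto simp: abs_le_iff)
  ultimately show ?thesis using that by (auto simp: nearest_def)
qed

text \<open>Subtracting the value of the density leaves a weakly singular integrand.  Its bound is uniform in
  \<open>z\<close> as long as \<open>\<eta> s\<close> is a curve point nearest to \<open>z\<close>, because then
  \<open>|\<eta> t - \<eta> s| \<le> 2 |\<eta> t - z|\<close>; this covers tangential approach to the curve.\<close>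

definition cauchy_diff :: "(real \<Rightarrow> complex) \<Rightarrow> real \<Rightarrow> complex \<Rightarrow> real \<Rightarrow> complex" where
  "cauchy_diff \<psi> s z x = (\<psi> (s + x) - \<psi> s) * \<eta>' (s + x) / (\<eta> (s + x) - z)"

definition cauchy_diff_int :: "(real \<Rightarrow> complex) \<Rightarrow> real \<Rightarrow> complex" where
  "cauchy_diff_int \<psi> s = integral {-pi..pi} (cauchy_diff \<psi> s (\<eta> s))"

lemma nearest_lower_bound:
  obtains c where "c > 0"
    "\<And>s z x. nearest s z \<Longrightarrow> \<bar>x\<bar> \<le> pi \<Longrightarrow> c * \<bar>x\<bar> \<le> norm (\<eta> (s + x) - z)"
proof -
  obtain c where c: "c > 0" "\<And>s t. \<bar>s - t\<bar> \<le> pi \<Longrightarrow> c * \<bar>s - t\<bar> \<le> norm (\<eta> s - \<eta> t)"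
    using chord_arc by metis
  show ?thesis
  proof (rule that[of "c / 2"])
    fix s z x assume *: "nearest s z" "\<bar>x\<bar> \<le> pi"
    have "c * \<bar>x\<bar> \<le> norm (\<eta> (s + x) - \<eta> s)" using c(2)[of "s + x" s] * by simp
    also have "\<dots> \<le> norm (\<eta> (s + x) - z) + norm (\<eta> s - z)"
      using norm_triangle_ineq4[of "\<eta> (s + x) - z" "\<eta> s - z"] by simp
    also have "\<dots> \<le> 2 * norm (\<eta> (s + x) - z)" using * by (simp add: nearest_def)
    finally show "c / 2 * \<bar>x\<bar> \<le> norm (\<eta> (s + x) - z)" by simp
  qed (use c in simp)
qed

text \<open>A point \<open>z\<close> on the curve with \<open>nearest s z\<close> is
  \<open>\<eta> s\<close> itself. So points on and off the curve are treated alike, and only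
  \<open>x = 0\<close> can be singular.\<close>

lemma nearest_nonzero:
  assumes "nearest s z" "x \<in> {-pi..pi} - {0}"
  shows "\<eta> (s + x) \<noteq> z"
proof -
  obtain c where c: "c > 0"
    "\<And>s z x. nearest s z \<Longrightarrow> \<bar>x\<bar> \<le> pi \<Longrightarrow> c * \<bar>x\<bar> \<le> norm (\<eta> (s + x) - z)"
    using nearest_lower_bound by metis
  have "\<bar>x\<bar> \<le> pi" "0 < c * \<bar>x\<bar>" using assms(2) c(1) by (auto simp: abs_le_iff)
  with c(2)[OF assms(1)] show ?thesis by fastforce
qed

lemma cauchy_diff_bound:
  assumes "0 \<le> H" "\<And>s t. \<bar>s - t\<bar> \<le> 2 * pi \<Longrightarrow> norm (\<psi> s - \<psi> t) \<le> H * \<bar>s - t\<bar> powr \<alpha>"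
  obtains C where "C > 0" "\<And>s z x. nearest s z \<Longrightarrow> \<bar>x\<bar> \<le> pi \<Longrightarrow>
    norm (cauchy_diff \<psi> s z x) \<le> C * \<bar>x\<bar> powr (\<alpha> - 1)"
proof -
  obtain c where c: "c > 0"
    "\<And>s z x. nearest s z \<Longrightarrow> \<bar>x\<bar> \<le> pi \<Longrightarrow> c * \<bar>x\<bar> \<le> norm (\<eta> (s + x) - z)"
    using nearest_lower_bound by metis
  obtain L where L: "L > 0" "\<And>t. norm (\<eta>' t) \<le> L" using deriv_bounds by metis
  show ?thesis
  \<comment> \<open>\<open>H + 1\<close> instead of \<open>H\<close> keeps the constant positive for
    a constant density.\<close>
  proof (rule that[of "(H + 1) * L / c"])
    show "(H + 1) * L / c > 0" using assms(1) c(1) L(1) by (simp add: add_nonneg_pos)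
    fix s z x assume *: "nearest s z" "\<bar>x\<bar> \<le> pi"
    show "norm (cauchy_diff \<psi> s z x) \<le> (H + 1) * L / c * \<bar>x\<bar> powr (\<alpha> - 1)"
    \<comment> \<open>At \<open>x = 0\<close> the numerator vanishes, so both sides are 0 even if
      the denominator vanishes too.\<close>
    proof (cases "x = 0")
      case False
      then have x: "\<bar>x\<bar> > 0" by simp
      have "norm (\<psi> (s + x) - \<psi> s) \<le> H * \<bar>x\<bar> powr \<alpha>" using assms(2)[of "s + x" s] * by simp
      also have "\<dots> \<le> (H + 1) * \<bar>x\<bar> powr \<alpha>" by (intro mult_right_mono) auto
      finally have "norm (cauchy_diff \<psi> s z x) \<le> ((H + 1) * \<bar>x\<bar> powr \<alpha>) * L / (c * \<bar>x\<bar>)"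
        unfolding cauchy_diff_def norm_mult norm_divide
        using L c(1) c(2)[OF *] x assms(1) by (intro frac_le mult_mono) auto
      also have "\<dots> = (H + 1) * L / c * \<bar>x\<bar> powr (\<alpha> - 1)"
        using x c(1) by (simp add: powr_diff)
      finally show ?thesis .
    qed (simp add: cauchy_diff_def)
  qed
qed

lemma cauchy_diff_integrable:
  assumes "hoelder2pi \<psi>" "nearest s z"
  shows "cauchy_diff \<psi> s z integrable_on {-pi..pi}"
proof -
  obtain H \<alpha> where H: "0 < \<alpha>" "0 \<le> H"
    "\<And>s t. \<bar>s - t\<bar> \<le> 2 * pi \<Longrightarrow> norm (\<psi> s - \<psi> t) \<le> H * \<bar>s - t\<bar> powr \<alpha>"
    using assms(1) unfolding hoelder2pi_def by blast
  obtain C where C: "\<And>s z x. nearest s z \<Longrightarrow> \<bar>x\<bar> \<le> pi \<Longrightarrow>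
    norm (cauchy_diff \<psi> s z x) \<le> C * \<bar>x\<bar> powr (\<alpha> - 1)"
    using cauchy_diff_bound[OF H(2,3)] by metis
  show ?thesis
  proof (rule integrable_weakly_singular[OF _ H(1)])
    show "continuous_on ({-pi..pi} - {0}) (cauchy_diff \<psi> s z)"
      unfolding cauchy_diff_def
      by (intro continuous_intros continuous_on_compose2[OF continuous_eta[of UNIV]]
          continuous_on_compose2[OF continuous_eta'[of UNIV]]
          continuous_on_compose2[OF hoelder2pi_continuous[OF assms(1), of UNIV]])
        (use nearest_nonzero[OF assms(2)] in auto)
    show "norm (cauchy_diff \<psi> s z x) \<le> C * \<bar>x\<bar> powr (\<alpha> - 1)" if "x \<in> {-pi..pi} - {0}" for x
      using C[OF assms(2)] that by (simp add: abs_le_iff)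
  qed
qed

text \<open>The base points vary along with the \<open>zn\<close>, because the nearest parameter
  does; the majorant is still independent of \<open>n\<close>, as the bound is uniform over all
  nearest pairs.\<close>

lemma cauchy_diff_tendsto:
  assumes "hoelder2pi \<psi>" "\<And>n. nearest (sn n) (zn n)" "sn \<longlonglongrightarrow> s" "zn \<longlonglongrightarrow> \<eta> s"
  shows "(\<lambda>n. integral {-pi..pi} (cauchy_diff \<psi> (sn n) (zn n))) \<longlonglongrightarrow> cauchy_diff_int \<psi> s"
  unfolding cauchy_diff_int_def
proof -
  obtain H \<alpha> where H: "0 < \<alpha>" "0 \<le> H"
    "\<And>s t. \<bar>s - t\<bar> \<le> 2 * pi \<Longrightarrow> norm (\<psi> s - \<psi> t) \<le> H * \<bar>s - t\<bar> powr \<alpha>"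
    using assms(1) unfolding hoelder2pi_def by blast
  obtain C where C: "\<And>s z x. nearest s z \<Longrightarrow> \<bar>x\<bar> \<le> pi \<Longrightarrow>
    norm (cauchy_diff \<psi> s z x) \<le> C * \<bar>x\<bar> powr (\<alpha> - 1)"
    using cauchy_diff_bound[OF H(2,3)] by metis
  show "(\<lambda>n. integral {-pi..pi} (cauchy_diff \<psi> (sn n) (zn n))) \<longlonglongrightarrow>
      integral {-pi..pi} (cauchy_diff \<psi> s (\<eta> s))"
  proof (rule dominated_convergence)
    show "cauchy_diff \<psi> (sn n) (zn n) integrable_on {-pi..pi}" for n
      by (rule cauchy_diff_integrable[OF assms(1,2)])
    show "(\<lambda>x. C * \<bar>x\<bar> powr (\<alpha> - 1)) integrable_on {-pi..pi}"
      using H(1) by (intro integrable_on_mult_right integrable_abs_powr) auto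
    show "norm (cauchy_diff \<psi> (sn n) (zn n) x) \<le> C * \<bar>x\<bar> powr (\<alpha> - 1)" if "x \<in> {-pi..pi}" for n x
      using C[OF assms(2)] that by (simp add: abs_le_iff)
    show "(\<lambda>n. cauchy_diff \<psi> (sn n) (zn n) x) \<longlonglongrightarrow> cauchy_diff \<psi> s (\<eta> s) x" if "x \<in> {-pi..pi}" for x
    proof (cases "x = 0")
      case False
      have cont: "(\<lambda>n. g (sn n + y)) \<longlonglongrightarrow> g (s + y)" if "continuous_on UNIV g" for g :: "real \<Rightarrow> complex" and y
        using that assms(3)
        by (intro isCont_tendsto_compose[of _ g]) (auto simp: continuous_on_eq_continuous_at intro!: tendsto_intros)
      show ?thesis
        unfolding cauchy_diff_def
        using nearest_nonzero[OF nearest_self, of x s] that False assms(4)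
        by (intro tendsto_intros cont cont[where y = 0, simplified] continuous_eta continuous_eta'
            hoelder2pi_continuous[OF assms(1)]) auto
    qed (simp add: cauchy_diff_def)
  qed
qed

lemma window_integral:
  fixes f :: "real \<Rightarrow> complex"
  assumes "periodic2pi f" "continuous_on UNIV f"
  shows "integral {0..2 * pi} f = integral {-pi..pi} (\<lambda>x. f (s + x))"
  using integral_periodic_window[OF assms, of "s - pi"]
    integral_shift_real_ivl[of "s - pi" s "s + pi" f]
  by (simp add: algebra_simps)

text \<open>The base point \<open>s\<close> is arbitrary here, so it can later be chosen nearest to
  \<open>z\<close>.\<close>

lemma cauchy_integral_split:
  assumes "hoelder2pi \<psi>" "z \<notin> range \<eta>"
  shows "integral {0..2 * pi} (\<lambda>t. \<psi> t * \<eta>' t / (\<eta> t - z)) =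
    integral {-pi..pi} (cauchy_diff \<psi> s z) + \<psi> s * integral {0..2 * pi} (\<lambda>t. \<eta>' t / (\<eta> t - z))"
proof -
  have per: "\<psi> (t + 2 * pi) = \<psi> t" "\<eta> (t + 2 * pi) = \<eta> t" "\<eta>' (t + 2 * pi) = \<eta>' t" for t
    using assms(1) periodic periodic' by (auto simp: hoelder2pi_def periodic2pi_def)
  have cont: "continuous_on S (\<lambda>t. \<eta>' t / (\<eta> t - z))"
    "continuous_on S (\<lambda>t. (\<psi> t - \<psi> s) * \<eta>' t / (\<eta> t - z))" for S
    using assms(2) by (auto intro!: continuous_intros continuous_eta continuous_eta' hoelder2pi_continuous[OF assms(1)])
  have "integral {0..2 * pi} (\<lambda>t. \<psi> t * \<eta>' t / (\<eta> t - z)) =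
    integral {0..2 * pi} (\<lambda>t. (\<psi> t - \<psi> s) * \<eta>' t / (\<eta> t - z) + \<psi> s * (\<eta>' t / (\<eta> t - z)))"
    by (simp add: left_diff_distrib diff_divide_distrib)
  also have "\<dots> = integral {0..2 * pi} (\<lambda>t. (\<psi> t - \<psi> s) * \<eta>' t / (\<eta> t - z)) +
      \<psi> s * integral {0..2 * pi} (\<lambda>t. \<eta>' t / (\<eta> t - z))"
    by (subst integral_add)
      (auto intro!: integrable_continuous_real integrable_on_mult_right cont simp del: times_divide_eq_right)
  also have "integral {0..2 * pi} (\<lambda>t. (\<psi> t - \<psi> s) * \<eta>' t / (\<eta> t - z)) =
      integral {-pi..pi} (cauchy_diff \<psi> s z)"
    unfolding cauchy_diff_def using cont(2)[of UNIV]
    by (subst window_integral[where s = s]) (auto simp: periodic2pi_def per)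
  finally show ?thesis .
qed

text \<open>\<open>S\<close> is any set off the curve on which the winding integral is constant, so
  one proof serves both sides. Each \<open>zn\<close> is split at its own nearest parameter;
  sequences are used because dominated convergence is sequential.\<close>

lemma plemelj:
  assumes "hoelder2pi \<psi>" "S \<inter> range \<eta> = {}"
    "\<And>z. z \<in> S \<Longrightarrow> integral {0..2 * pi} (\<lambda>t. \<eta>' t / (\<eta> t - z)) = w"
  shows "((\<lambda>z. integral {0..2 * pi} (\<lambda>t. \<psi> t * \<eta>' t / (\<eta> t - z))) \<longlongrightarrow> cauchy_diff_int \<psi> s + \<psi> s * w)
    (at (\<eta> s) within S)"
  unfolding tendsto_at_iff_sequentially
proof (intro allI impI)
  fix zn assume zn: "\<forall>i. zn i \<in> S - {\<eta> s}" "zn \<longlonglongrightarrow> \<eta> s"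
  have "\<forall>n. \<exists>x. \<bar>x - s\<bar> \<le> pi \<and> nearest x (zn n)" using nearest_exists by metis
  then obtain sn where sn: "\<And>n. \<bar>sn n - s\<bar> \<le> pi" "\<And>n. nearest (sn n) (zn n)" by metis
  obtain c where c: "c > 0" "\<And>s t. \<bar>s - t\<bar> \<le> pi \<Longrightarrow> c * \<bar>s - t\<bar> \<le> norm (\<eta> s - \<eta> t)"
    using chord_arc by metis
  \<comment> \<open>\<open>\<eta> (sn n)\<close> is no farther from \<open>zn n\<close> than
    \<open>\<eta> s\<close> is, hence within twice |zn n - \<eta> s| of \<open>\<eta> s\<close>; the
    chord-arc bound carries this over to the parameters.\<close>
  have "sn \<longlonglongrightarrow> s"
  proof (subst Lim_null, rule Lim_null_comparison)
    show "\<forall>\<^sub>F n in sequentially. norm (sn n - s) \<le> 2 / c * norm (zn n - \<eta> s)"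
    proof (intro always_eventually allI)
      fix n
      have "c * \<bar>sn n - s\<bar> \<le> norm (\<eta> (sn n) - \<eta> s)" using c(2) sn(1) by blast
      also have "\<dots> \<le> norm (\<eta> (sn n) - zn n) + norm (zn n - \<eta> s)"
        using norm_triangle_ineq[of "\<eta> (sn n) - zn n" "zn n - \<eta> s"] by simp
      also have "norm (\<eta> (sn n) - zn n) \<le> norm (\<eta> s - zn n)" using sn(2) by (simp add: nearest_def)
      finally show "norm (sn n - s) \<le> 2 / c * norm (zn n - \<eta> s)"
        using c(1) by (simp add: norm_minus_commute field_simps)
    qed
    have "(\<lambda>n. 2 / c * norm (zn n - \<eta> s)) \<longlonglongrightarrow> 2 / c * norm (\<eta> s - \<eta> s)"
      by (intro tendsto_intros zn)
    then show "(\<lambda>n. 2 / c * norm (zn n - \<eta> s)) \<longlonglongrightarrow> 0" by simp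
  qed
  then have "(\<lambda>n. integral {-pi..pi} (cauchy_diff \<psi> (sn n) (zn n)) + \<psi> (sn n) * w) \<longlonglongrightarrow> cauchy_diff_int \<psi> s + \<psi> s * w"
    using hoelder2pi_continuous[OF assms(1), of UNIV]
    by (intro tendsto_intros cauchy_diff_tendsto assms sn zn isCont_tendsto_compose[of _ \<psi>])
      (auto simp: continuous_on_eq_continuous_at)
  moreover have "integral {-pi..pi} (cauchy_diff \<psi> (sn n) (zn n)) + \<psi> (sn n) * w =
      ((\<lambda>z. integral {0..2 * pi} (\<lambda>t. \<psi> t * \<eta>' t / (\<eta> t - z))) \<circ> zn) n" for n
    unfolding o_def
  proof (subst cauchy_integral_split[OF assms(1), where s = "sn n"])
    show "zn n \<notin> range \<eta>" using zn(1) assms(2) by blast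
  qed (use assms(3) zn(1) in auto)
  ultimately show "((\<lambda>z. integral {0..2 * pi} (\<lambda>t. \<psi> t * \<eta>' t / (\<eta> t - z))) \<circ> zn) \<longlonglongrightarrow> cauchy_diff_int \<psi> s + \<psi> s * w"
    by (simp add: o_def)
qed

text \<open>A theorem of Plemelj-Privalov type with exponent \<open>\<alpha> / 2\<close>, which is
  what puts \<open>h\<close> into H.\<close>

lemma hoelder2pi_cauchy_diff_int:
  assumes "hoelder2pi \<psi>"
  shows "hoelder2pi (cauchy_diff_int \<psi>)"
proof -
  obtain H \<alpha> where H: "0 < \<alpha>" "\<alpha> \<le> 1" "0 \<le> H"
    "\<And>s t. \<bar>s - t\<bar> \<le> 2 * pi \<Longrightarrow> norm (\<psi> s - \<psi> t) \<le> H * \<bar>s - t\<bar> powr \<alpha>"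
    and per\<psi>: "periodic2pi \<psi>"
    using assms(1) unfolding hoelder2pi_def by blast
  obtain C where C: "C > 0" "\<And>s z x. nearest s z \<Longrightarrow> \<bar>x\<bar> \<le> pi \<Longrightarrow>
    norm (cauchy_diff \<psi> s z x) \<le> C * \<bar>x\<bar> powr (\<alpha> - 1)"
    using cauchy_diff_bound[OF H(3,4)] by metis
  obtain c where c: "c > 0"
    "\<And>s z x. nearest s z \<Longrightarrow> \<bar>x\<bar> \<le> pi \<Longrightarrow> c * \<bar>x\<bar> \<le> norm (\<eta> (s + x) - z)"
    using nearest_lower_bound by metis
  obtain L where L: "L > 0" "\<And>t. norm (\<eta>' t) \<le> L" "\<And>s t. norm (\<eta>' s - \<eta>' t) \<le> L * \<bar>s - t\<bar>"
    using deriv_bounds by metis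
  \<comment> \<open>The three summands are the constants of the three terms of the telescoped
    difference below.\<close>
  define K where "K = (H + H) * L / c + (H * pi powr \<alpha>) * (L * (2 * pi) powr (1 - \<alpha>)) / c +
      (H * pi powr \<alpha>) * L * (L * (2 * pi) powr (1 - \<alpha>)) / (c * c)"
  have K0: "K \<ge> 0" using H L c unfolding K_def by (intro add_nonneg_nonneg divide_nonneg_pos mult_nonneg_nonneg) auto
  have diff: "norm (cauchy_diff \<psi> s (\<eta> s) x - cauchy_diff \<psi> s' (\<eta> s') x) \<le> K * \<bar>s - s'\<bar> powr \<alpha> / \<bar>x\<bar>"
    if x: "\<bar>x\<bar> \<le> pi" "x \<noteq> 0" and d: "\<bar>s - s'\<bar> \<le> 2 * pi" for s s' x
  proof -
    define d where "d = \<bar>s - s'\<bar>"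
    define D where "D = d powr \<alpha>"
    \<comment> \<open>Converts Lipschitz estimates in \<open>d\<close> into estimates of order
      \<alpha>, so that all three terms carry the same factor \<open>D\<close>.\<close>
    have dD: "d \<le> (2 * pi) powr (1 - \<alpha>) * D"
      using powr_le_powr_bounded[of d "2 * pi" \<alpha> 1] d H by (simp add: d_def D_def)
    have D0: "D \<ge> 0" by (simp add: D_def)
    define p p' where "p = \<psi> (s + x) - \<psi> s" and "p' = \<psi> (s' + x) - \<psi> s'"
    define e e' where "e = \<eta>' (s + x)" and "e' = \<eta>' (s' + x)"
    define w w' where "w = \<eta> (s + x) - \<eta> s" and "w' = \<eta> (s' + x) - \<eta> s'"
    have w: "c * \<bar>x\<bar> \<le> norm w" "c * \<bar>x\<bar> \<le> norm w'"
      unfolding w_def w'_def using c(2)[OF nearest_self] x by auto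
    have cx: "0 < c * \<bar>x\<bar>" using c(1) x by simp
    with w have w0: "w \<noteq> 0" "w' \<noteq> 0" by auto
    have p: "norm (p - p') \<le> (H + H) * D"
    proof -
      have "p - p' = (\<psi> (s + x) - \<psi> (s' + x)) - (\<psi> s - \<psi> s')" by (simp add: p_def p'_def)
      then have "norm (p - p') \<le> norm (\<psi> (s + x) - \<psi> (s' + x)) + norm (\<psi> s - \<psi> s')"
        by (metis norm_triangle_ineq4)
      also have "\<dots> \<le> H * D + H * D"
        using H(4)[of "s + x" "s' + x"] H(4)[of s s'] d by (simp add: D_def d_def)
      finally show ?thesis by (simp add: algebra_simps)
    qed
    have p': "norm p' \<le> H * pi powr \<alpha>"
    proof -
      have "norm p' \<le> H * \<bar>x\<bar> powr \<alpha>" using H(4)[of "s' + x" s'] x by (simp add: p'_def)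
      also have "\<dots> \<le> H * pi powr \<alpha>" using H x by (intro mult_left_mono powr_mono2) auto
      finally show ?thesis .
    qed
    have e: "norm (e - e') \<le> L * (2 * pi) powr (1 - \<alpha>) * D"
    proof -
      have "L * d \<le> L * ((2 * pi) powr (1 - \<alpha>) * D)" using dD L(1) by (intro mult_left_mono) auto
      then show ?thesis using L(3)[of "s + x" "s' + x"] by (simp add: e_def e'_def d_def mult.assoc)
    qed
    \<comment> \<open>A second difference of \<open>\<eta>\<close>: the mean value bound for
      \<open>\<eta> (y + s') - \<eta> (y + s)\<close> between 0 and \<open>x\<close> yields the
      extra factor |x|, which cancels one of the two in the denominator
      \<open>w * w'\<close>.\<close>
    have ww: "norm (w' - w) \<le> L * (2 * pi) powr (1 - \<alpha>) * D * \<bar>x\<bar>"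
    proof -
      have "norm ((\<lambda>y. \<eta> (y + s') - \<eta> (y + s)) x - (\<lambda>y. \<eta> (y + s') - \<eta> (y + s)) 0) \<le> L * d * \<bar>x - 0\<bar>"
      proof (rule norm_diff_le_deriv_bound)
        show "((\<lambda>y. \<eta> (y + s') - \<eta> (y + s)) has_vector_derivative (\<eta>' (t + s') - \<eta>' (t + s))) (at t)" for t
          by (intro has_vector_derivative_diff has_vector_derivative_shift has_deriv)
        show "norm (\<eta>' (t + s') - \<eta>' (t + s)) \<le> L * d" for t
          using L(3)[of "t + s'" "t + s"] by (simp add: d_def abs_minus_commute)
      qed
      also have "\<dots> \<le> L * ((2 * pi) powr (1 - \<alpha>) * D) * \<bar>x\<bar>"
        using mult_right_mono[OF mult_left_mono[OF dD, of L], of "\<bar>x\<bar>"] L(1) by simp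
      finally show ?thesis by (simp add: w_def w'_def algebra_simps)
    qed
    \<comment> \<open>Exchange \<open>p\<close>, \<open>e\<close> and \<open>w\<close> for their
      primed versions one at a time.\<close>
    have "cauchy_diff \<psi> s (\<eta> s) x - cauchy_diff \<psi> s' (\<eta> s') x =
        (p - p') * e / w + p' * (e - e') / w + p' * e' * (w' - w) / (w * w')"
      unfolding cauchy_diff_def p_def[symmetric] p'_def[symmetric] e_def[symmetric] e'_def[symmetric]
        w_def[symmetric] w'_def[symmetric]
      using w0 by (simp add: field_simps)
    also have "norm \<dots> \<le> norm ((p - p') * e / w) + norm (p' * (e - e') / w) + norm (p' * e' * (w' - w) / (w * w'))"
      by (metis norm_triangle_ineq norm_triangle_mono order_refl)
    also have "\<dots> \<le> ((H + H) * D) * L / (c * \<bar>x\<bar>) +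
        (H * pi powr \<alpha>) * (L * (2 * pi) powr (1 - \<alpha>) * D) / (c * \<bar>x\<bar>) +
        (H * pi powr \<alpha>) * L * (L * (2 * pi) powr (1 - \<alpha>) * D * \<bar>x\<bar>) / ((c * \<bar>x\<bar>) * (c * \<bar>x\<bar>))"
      unfolding norm_mult norm_divide
      using p p' e ww w cx L D0 H(3) by (intro add_mono frac_le mult_mono) (auto simp: e_def e'_def)
    also have "\<dots> = K * D / \<bar>x\<bar>" using x c(1) by (simp add: K_def field_simps)
    finally show ?thesis by (simp add: D_def d_def)
  qed
  \<comment> \<open>The geometric mean of the constants \<open>2 * C\<close>, from the weak
    singularity bound for each of the two terms, and \<open>K\<close>.\<close>
  define E where "E = sqrt (2 * C * K)"
  have E2: "E\<^sup>2 = 2 * C * K" using K0 C(1) by (simp add: E_def)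
  define J where "J = integral {-pi..pi} (\<lambda>x. \<bar>x\<bar> powr (\<alpha> / 2 - 1))"
  \<comment> \<open>Of the two bounds, \<open>C |x|^(\<alpha> - 1)\<close> does not decay in \<open>|s - s'|\<close> and \<open>diff\<close> is not integrable in
    \<open>x\<close>; their geometric mean has both properties, at the cost of halving the exponent.\<close>
  have mean: "norm (cauchy_diff \<psi> s (\<eta> s) x - cauchy_diff \<psi> s' (\<eta> s') x) \<le>
      E * \<bar>s - s'\<bar> powr (\<alpha> / 2) * \<bar>x\<bar> powr (\<alpha> / 2 - 1)"
    if x: "\<bar>x\<bar> \<le> pi" and d: "\<bar>s - s'\<bar> \<le> 2 * pi" for s s' x
  proof (cases "x = 0")
    case False
    let ?n = "norm (cauchy_diff \<psi> s (\<eta> s) x - cauchy_diff \<psi> s' (\<eta> s') x)"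
    have "?n \<le> C * \<bar>x\<bar> powr (\<alpha> - 1) + C * \<bar>x\<bar> powr (\<alpha> - 1)"
      using norm_triangle_ineq4[of "cauchy_diff \<psi> s (\<eta> s) x" "cauchy_diff \<psi> s' (\<eta> s') x"]
        C(2)[OF nearest_self x, of s] C(2)[OF nearest_self x, of s'] by linarith
    then have "?n * ?n \<le> (2 * C * \<bar>x\<bar> powr (\<alpha> - 1)) * (K * \<bar>s - s'\<bar> powr \<alpha> / \<bar>x\<bar>)"
      using diff[OF x False d] C(1) by (intro mult_mono) auto
    also have "\<dots> = (2 * C * K) * (\<bar>s - s'\<bar> powr (\<alpha> / 2) * \<bar>x\<bar> powr (\<alpha> / 2 - 1))\<^sup>2"
    proof -
      have "(\<bar>s - s'\<bar> powr (\<alpha> / 2))\<^sup>2 = \<bar>s - s'\<bar> powr \<alpha>"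
        by (simp add: power2_eq_square flip: powr_add)
      moreover have "(\<bar>x\<bar> powr (\<alpha> / 2 - 1))\<^sup>2 = \<bar>x\<bar> powr (\<alpha> - 1) / \<bar>x\<bar>"
      proof -
        have "(\<bar>x\<bar> powr (\<alpha> / 2 - 1))\<^sup>2 = \<bar>x\<bar> powr ((\<alpha> - 1) - 1)"
          by (simp add: power2_eq_square flip: powr_add)
        also have "\<dots> = \<bar>x\<bar> powr (\<alpha> - 1) / \<bar>x\<bar>" using False by (subst powr_diff) simp
        finally show ?thesis .
      qed
      ultimately show ?thesis by (simp add: power_mult_distrib)
    qed
    finally have "?n\<^sup>2 \<le> (E * (\<bar>s - s'\<bar> powr (\<alpha> / 2) * \<bar>x\<bar> powr (\<alpha> / 2 - 1)))\<^sup>2"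
      unfolding power_mult_distrib[of E] E2 by (simp add: power2_eq_square)
    then have "?n \<le> E * (\<bar>s - s'\<bar> powr (\<alpha> / 2) * \<bar>x\<bar> powr (\<alpha> / 2 - 1))"
      by (rule power2_le_imp_le) (use K0 C(1) in \<open>simp add: E_def\<close>)
    then show ?thesis by (simp add: mult.assoc)
  qed (simp add: cauchy_diff_def)
  show ?thesis
  proof (rule hoelder2piI[of _ "\<alpha> / 2" "E * J"])
    show "periodic2pi (cauchy_diff_int \<psi>)"
      unfolding periodic2pi_def
    proof
      fix t
      have "cauchy_diff \<psi> (t + 2 * pi) (\<eta> (t + 2 * pi)) x = cauchy_diff \<psi> t (\<eta> t) x" for x
      proof -
        have per: "f (t + 2 * pi + x) = f (t + x)" "f (t + 2 * pi) = f t" if "periodic2pi f" for f :: "real \<Rightarrow> complex"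
          using that unfolding periodic2pi_def by (metis add.commute add.left_commute)+
        show ?thesis unfolding cauchy_diff_def by (simp add: per periodic periodic' per\<psi>)
      qed
      then show "cauchy_diff_int \<psi> (t + 2 * pi) = cauchy_diff_int \<psi> t" by (simp add: cauchy_diff_int_def cong: integral_cong)
    qed
    fix s s' :: real assume d: "\<bar>s - s'\<bar> \<le> 2 * pi"
    have int: "(\<lambda>x. cauchy_diff \<psi> s (\<eta> s) x - cauchy_diff \<psi> s' (\<eta> s') x) integrable_on {-pi..pi}"
      by (intro integrable_diff cauchy_diff_integrable assms nearest_self)
    have int': "(\<lambda>x. E * \<bar>s - s'\<bar> powr (\<alpha> / 2) * \<bar>x\<bar> powr (\<alpha> / 2 - 1)) integrable_on {-pi..pi}"
      using H by (intro integrable_on_mult_right integrable_abs_powr) auto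
    have le: "norm (cauchy_diff \<psi> s (\<eta> s) x - cauchy_diff \<psi> s' (\<eta> s') x) \<le>
        E * \<bar>s - s'\<bar> powr (\<alpha> / 2) * \<bar>x\<bar> powr (\<alpha> / 2 - 1)" if "x \<in> {-pi..pi}" for x
      by (rule mean[OF _ d]) (use that in \<open>simp add: abs_le_iff\<close>)
    have "cauchy_diff_int \<psi> s - cauchy_diff_int \<psi> s' = integral {-pi..pi} (\<lambda>x. cauchy_diff \<psi> s (\<eta> s) x - cauchy_diff \<psi> s' (\<eta> s') x)"
      unfolding cauchy_diff_int_def by (intro integral_diff[symmetric] cauchy_diff_integrable assms nearest_self)
    moreover have "norm (integral {-pi..pi} (\<lambda>x. cauchy_diff \<psi> s (\<eta> s) x - cauchy_diff \<psi> s' (\<eta> s') x)) \<le>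
        integral {-pi..pi} (\<lambda>x. E * \<bar>s - s'\<bar> powr (\<alpha> / 2) * \<bar>x\<bar> powr (\<alpha> / 2 - 1))"
      by (rule Henstock_Kurzweil_Integration.integral_norm_bound_integral[OF int int' le])
    moreover have "integral {-pi..pi} (\<lambda>x. E * \<bar>s - s'\<bar> powr (\<alpha> / 2) * \<bar>x\<bar> powr (\<alpha> / 2 - 1)) =
        E * \<bar>s - s'\<bar> powr (\<alpha> / 2) * J"
      unfolding J_def by (rule integral_mult_right)
    ultimately have "norm (cauchy_diff_int \<psi> s - cauchy_diff_int \<psi> s') \<le> E * \<bar>s - s'\<bar> powr (\<alpha> / 2) * J"
      by (simp only:)
    then show "norm (cauchy_diff_int \<psi> s - cauchy_diff_int \<psi> s') \<le> E * J * \<bar>s - s'\<bar> powr (\<alpha> / 2)"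
      by (simp only: mult.assoc mult.commute[of J])
  qed (use H in auto)
qed

end

subsection \<open>The principal value\<close>

lemma continuous_on_shift:
  fixes f :: "real \<Rightarrow> complex"
  assumes "continuous_on UNIV f"
  shows "continuous_on A (\<lambda>x. f (s + x))"
  by (rule continuous_on_compose2[OF assms]) (auto intro!: continuous_intros)

text \<open>Differentiation under the integral. It is stated for an arbitrary arc, because it is
  needed both for whole curves and for the part of a curve away from the singular parameter.\<close>

lemma cauchy_type_holomorphic:
  fixes g p :: "real \<Rightarrow> complex"
  assumes g: "continuous_on {a..b} g" and p: "continuous_on {a..b} p"
  shows "(\<lambda>z. integral {a..b} (\<lambda>t. g t / (p t - z))) holomorphic_on - (p ` {a..b})"
proof -
  have op: "open (- (p ` {a..b}))"
    using compact_continuous_image[OF p] by (auto intro: compact_imp_closed)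
  have "(\<lambda>z. integral {a..b} (\<lambda>t. g t / (p t - z))) field_differentiable at z0"
    if z0: "z0 \<in> - (p ` {a..b})" for z0
  proof -
    \<comment> \<open>The Leibniz rule asks for a convex domain, so differentiability is checked on
      a ball around each point.\<close>
    obtain e where e: "e > 0" "ball z0 e \<subseteq> - (p ` {a..b})"
      using openE[OF op z0] by metis
    then have nz: "p t - z \<noteq> 0" if "z \<in> ball z0 e" "t \<in> {a..b}" for z t
      using that by (metis ComplD eq_iff_diff_eq_0 imageI subsetD)
    have "(\<lambda>z. integral (cbox a b) (\<lambda>t. g t / (p t - z))) holomorphic_on ball z0 e"
    proof (rule leibniz_rule_holomorphic)
      show "((\<lambda>z. g t / (p t - z)) has_field_derivative (g t / (p t - z)\<^sup>2)) (at z within ball z0 e)"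
        if "z \<in> ball z0 e" "t \<in> cbox a b" for z t
        using nz[of z t] that by (auto intro!: derivative_eq_intros simp: power2_eq_square)
      show "(\<lambda>t. g t / (p t - z)) integrable_on cbox a b" if "z \<in> ball z0 e" for z
        using nz[OF that] by (auto intro!: integrable_continuous_real continuous_intros g p)
      have "continuous_on (ball z0 e \<times> cbox a b) (\<lambda>q. g (snd q))"
        by (rule continuous_on_compose2[OF g]) (auto intro!: continuous_intros)
      moreover have "continuous_on (ball z0 e \<times> cbox a b) (\<lambda>q. p (snd q))"
        by (rule continuous_on_compose2[OF p]) (auto intro!: continuous_intros)
      ultimately have "continuous_on (ball z0 e \<times> cbox a b) (\<lambda>q. g (snd q) / (p (snd q) - fst q)\<^sup>2)"
        using nz by (intro continuous_intros) auto
      then show "continuous_on (ball z0 e \<times> cbox a b) (\<lambda>(z, t). g t / (p t - z)\<^sup>2)"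
        by (simp add: split_def)
    qed auto
    then show ?thesis
      using e(1) by (auto simp: holomorphic_on_open field_differentiable_def)
  qed
  then show ?thesis
    using op by (auto simp: holomorphic_on_open field_differentiable_def)
qed

lemma cauchy_type_tendsto:
  fixes g p :: "real \<Rightarrow> complex"
  assumes "continuous_on {a..b} g" "continuous_on {a..b} p" "z0 \<notin> p ` {a..b}" "(f \<longlongrightarrow> z0) F"
  shows "((\<lambda>x. integral {a..b} (\<lambda>t. g t / (p t - f x))) \<longlongrightarrow> integral {a..b} (\<lambda>t. g t / (p t - z0))) F"
proof -
  have "open (- (p ` {a..b}))"
    using compact_continuous_image[OF assms(2)] by (auto intro: compact_imp_closed)
  then have "isCont (\<lambda>z. integral {a..b} (\<lambda>t. g t / (p t - z))) z0"
    using holomorphic_on_imp_continuous_on[OF cauchy_type_holomorphic[OF assms(1,2)]] assms(3)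
    by (auto simp: continuous_on_eq_continuous_at)
  then show ?thesis using assms(4) by (rule isCont_tendsto_compose)
qed

context C2_loop
begin

section \<open>The principal value for the constant density\<close>

lemma winding_integral_values:
  assumes "z \<notin> range \<eta>"
  shows "integral {0..2 * pi} (\<lambda>t. \<eta>' t / (\<eta> t - z)) \<in> {0, - (2 * pi * \<i>)}"
  using assms winding_inside[of z] winding_outside[of z] inside_Un_outside[of "range \<eta>"] by blast

text \<open>The winding integral about the curve point \<open>\<eta> s\<close>, truncated
  symmetrically in parameters centred at \<open>s\<close>; its limit is the principal value for
  density 1.\<close>

definition pv_far :: "real \<Rightarrow> real \<Rightarrow> complex" where
  "pv_far s \<epsilon> = integral {-pi..-\<epsilon>} (\<lambda>x. \<eta>' (s + x) / (\<eta> (s + x) - \<eta> s)) +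
     integral {\<epsilon>..pi} (\<lambda>x. \<eta>' (s + x) / (\<eta> (s + x) - \<eta> s))"

text \<open>Despite its name no difference quotient: it is the increment of the curve, rotated and
  scaled so that its velocity at \<open>x = 0\<close> is 1. Thus \<open>slope s x\<close> is
  \<open>x\<close> to first order.\<close>

definition slope :: "real \<Rightarrow> real \<Rightarrow> complex" where
  "slope s x = (\<eta> (s + x) - \<eta> s) / \<eta>' s"

lemma slope_has_deriv: "(slope s has_vector_derivative (\<eta>' (s + x) / \<eta>' s)) (at x)"
proof -
  have "((\<lambda>x. \<eta> (x + s)) has_vector_derivative \<eta>' (s + x)) (at x)"
    by (rule has_vector_derivative_shift) (use has_deriv[of "x + s"] in \<open>simp add: add.commute\<close>)
  then have "((\<lambda>x. (\<eta> (x + s) - \<eta> s) / \<eta>' s) has_vector_derivative (\<eta>' (s + x) / \<eta>' s)) (at x)"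
    by (auto intro!: derivative_eq_intros)
  then show ?thesis by (simp add: slope_def[abs_def] add.commute)
qed

text \<open>The substitution \<open>f\<close> lets the limit be taken along
  \<open>\<epsilon>\<close> and along \<open>-\<epsilon>\<close>.\<close>

lemma slope_tendsto:
  assumes "LIM \<epsilon> at_right 0. f \<epsilon> :> at (0::real)"
  shows "((\<lambda>\<epsilon>. slope s (f \<epsilon>) / f \<epsilon>) \<longlongrightarrow> 1) (at_right 0)"
proof -
  have "((\<lambda>x. (slope s x - slope s 0 - (x - 0) *\<^sub>R (\<eta>' (s + 0) / \<eta>' s)) /\<^sub>R norm (x - 0)) \<longlongrightarrow> 0) (at 0)"
    using slope_has_deriv[of s 0] unfolding has_vector_derivative_def has_derivative_at_within by blast
  then have "((\<lambda>x. norm ((slope s x - x) /\<^sub>R \<bar>x\<bar>)) \<longlongrightarrow> 0) (at 0)"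
    using eta'_nonzero[of s] tendsto_norm_zero by (fastforce simp: slope_def scaleR_conv_of_real)
  then have "((\<lambda>x. slope s x / x - 1) \<longlongrightarrow> 0) (at 0)"
  proof (rule Lim_null_comparison[rotated])
    show "\<forall>\<^sub>F x in at 0. norm (slope s x / x - 1) \<le> norm ((slope s x - x) /\<^sub>R \<bar>x\<bar>)"
      unfolding eventually_at_filter
    proof (intro always_eventually allI impI)
      fix x :: real assume "x \<noteq> 0"
      then have "slope s x / x - 1 = (slope s x - x) / x" by (simp add: field_simps)
      then show "norm (slope s x / x - 1) \<le> norm ((slope s x - x) /\<^sub>R \<bar>x\<bar>)"
        by (simp add: norm_divide divide_inverse norm_mult norm_inverse mult.commute)
    qed
  qed
  then have "((\<lambda>x. slope s x / x) \<longlongrightarrow> 1) (at 0)" by (simp add: Lim_null[of _ 1])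
  from filterlim_compose[OF this assms] show ?thesis .
qed

text \<open>A nonzero real part keeps \<open>\<i> * \<sigma> * slope s x\<close> off the real axis,
  hence off the branch cut of \<open>Ln\<close>.\<close>

lemma slope_near:
  obtains r where "0 < r" "r \<le> pi" "\<And>x. \<bar>x\<bar> \<le> r \<Longrightarrow> x \<noteq> 0 \<Longrightarrow> Re (slope s x) \<noteq> 0"
proof -
  obtain L where L: "L > 0" "\<And>s x. norm (\<eta> (s + x) - \<eta> s - x *\<^sub>R \<eta>' s) \<le> \<bar>x\<bar> * (L * \<bar>x\<bar>)"
    using linearization by metis
  define a where "a = norm (\<eta>' s)"
  have a: "a > 0" using eta'_nonzero by (simp add: a_def)
  \<comment> \<open>Chosen so that \<open>slope s x\<close> deviates from \<open>x\<close> by at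
    most |x| / 2.\<close>
  define r where "r = min pi (a / (2 * L))"
  have r: "0 < r" "r \<le> pi" "r \<le> a / (2 * L)" using a L(1) by (auto simp: r_def)
  show ?thesis
  proof (rule that[OF r(1,2)])
    fix x :: real assume x: "\<bar>x\<bar> \<le> r" "x \<noteq> 0"
    have "slope s x - x = (\<eta> (s + x) - \<eta> s - x *\<^sub>R \<eta>' s) / \<eta>' s"
      using eta'_nonzero[of s] by (simp add: slope_def scaleR_conv_of_real field_simps)
    then have "norm (slope s x - x) \<le> \<bar>x\<bar> * (L * \<bar>x\<bar>) / a"
      using L(2)[of s x] a by (simp add: norm_divide a_def divide_right_mono)
    also have "\<dots> \<le> \<bar>x\<bar> * (1 / 2)"
    proof -
      have "L * \<bar>x\<bar> \<le> L * (a / (2 * L))" using x r L(1) by (intro mult_left_mono) auto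
      then have "L * \<bar>x\<bar> / a \<le> 1 / 2" using L(1) a by (simp add: field_simps)
      from mult_left_mono[OF this, of "\<bar>x\<bar>"] show ?thesis by simp
    qed
    also have "\<dots> < \<bar>x\<bar>" using x by simp
    finally have "\<bar>Re (slope s x) - x\<bar> < \<bar>x\<bar>"
      using abs_Re_le_cmod[of "slope s x - x"] by simp
    then show "Re (slope s x) \<noteq> 0" by auto
  qed
qed

text \<open>Move \<open>z\<close> to the curve point along the normal, from the side \<open>\<sigma> = \<plusminus>1\<close>.  Near the curve
  point the integral is a difference of logarithms, away from it it is continuous in \<open>z\<close>.\<close>

lemma winding_normal_limit:
  assumes r: "0 < \<epsilon>" "\<epsilon> \<le> r" "r \<le> pi" "\<And>x. \<bar>x\<bar> \<le> r \<Longrightarrow> x \<noteq> 0 \<Longrightarrow> Re (slope s x) \<noteq> 0"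
    and \<sigma>: "\<sigma> = 1 \<or> \<sigma> = (-1 :: real)"
  shows "pv_far s \<epsilon> + (Ln (\<i> * \<sigma> * slope s \<epsilon>) - Ln (\<i> * \<sigma> * slope s (-\<epsilon>))) \<in> {0, - (2 * pi * \<i>)}"
proof -
  \<comment> \<open>\<open>\<i> * \<eta>' s\<close> is the left normal, so
    \<open>\<sigma> = 1\<close> approaches from the left and \<open>\<sigma> = -1\<close> from the
    right.\<close>
  define zz where "zz = (\<lambda>\<delta>::real. \<eta> s + \<i> * \<sigma> * \<delta> * \<eta>' s)"
  define W where "W = (\<lambda>\<delta>. integral {0..2 * pi} (\<lambda>t. \<eta>' t / (\<eta> t - zz \<delta>)))"
  define k where "k = (\<lambda>\<delta> x. \<eta>' (s + x) / (\<eta> (s + x) - zz \<delta>))"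
  \<comment> \<open>\<open>\<eta> (s + x) - zz \<delta>\<close> up to a nonzero constant factor,
    which a logarithmic derivative does not see. The factor is chosen so that
    \<open>u \<delta> 0 = \<delta>\<close> is positive.\<close>
  define u where "u = (\<lambda>\<delta>::real. \<lambda>x. of_real \<delta> + \<i> * \<sigma> * slope s x)"
  have \<sigma>2: "complex_of_real \<sigma> * complex_of_real \<sigma> = 1" using \<sigma> by auto
  have u_eq: "\<eta> (s + x) - zz \<delta> = - (\<i> * \<sigma> * \<eta>' s) * u \<delta> x" for x \<delta>
  proof -
    have "- (\<i> * \<sigma> * \<eta>' s) * u \<delta> x = - (\<i> * \<sigma> * \<delta> * \<eta>' s) + (\<sigma> * \<sigma>) * (\<eta>' s * slope s x)"
      by (simp add: u_def algebra_simps)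
    also have "\<dots> = \<eta> (s + x) - zz \<delta>"
      unfolding of_real_mult \<sigma>2 using eta'_nonzero[of s] by (simp add: slope_def zz_def)
    finally show ?thesis ..
  qed
  \<comment> \<open>At \<open>x = 0\<close> the value is \<delta>; otherwise its imaginary part is
    \<open>\<sigma> * Re (slope s x)\<close>, which is nonzero. So a single branch of the logarithm
    covers the whole near arc.\<close>
  have u_near: "u \<delta> x \<notin> \<real>\<^sub>\<le>\<^sub>0" if "\<bar>x\<bar> \<le> r" "\<delta> > 0 \<or> \<delta> = 0 \<and> x \<noteq> 0" for \<delta> x
  proof (cases "x = 0")
    case True
    then show ?thesis using that by (auto simp: u_def slope_def complex_nonpos_Reals_iff)
  next
    case False
    then have "Im (u \<delta> x) \<noteq> 0" using r(4)[OF that(1) False] \<sigma> by (auto simp: u_def)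
    then show ?thesis by (auto simp: complex_nonpos_Reals_iff)
  qed
  have tozero: "((\<lambda>\<delta>. zz \<delta>) \<longlongrightarrow> \<eta> s) (at_right 0)"
  proof -
    have "((\<lambda>\<delta>. zz \<delta>) \<longlongrightarrow> \<eta> s + \<i> * \<sigma> * of_real 0 * \<eta>' s) (at_right 0)"
      unfolding zz_def by (intro tendsto_intros)
    then show ?thesis by simp
  qed
  have off_near: "\<eta> (s + x) \<noteq> zz \<delta>" if "\<bar>x\<bar> \<le> r" "\<delta> > 0" for x \<delta>
  proof -
    have "u \<delta> x \<noteq> 0" using u_near[of x \<delta>] that by auto
    moreover have "\<i> * \<sigma> * \<eta>' s \<noteq> 0" using \<sigma> eta'_nonzero[of s] by auto
    ultimately show ?thesis using u_eq[of x \<delta>] by auto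
  qed
  have img: "\<eta> s \<notin> (\<lambda>x. \<eta> (s + x)) ` A" if "A \<subseteq> {-pi..pi} - {0}" for A
  proof
    assume "\<eta> s \<in> (\<lambda>x. \<eta> (s + x)) ` A"
    then obtain x where x: "x \<in> A" "\<eta> s = \<eta> (s + x)" by auto
    with that have "x \<in> {-pi..pi} - {0}" by auto
    from nearest_nonzero[OF nearest_self this] x(2) show False by metis
  qed
  have cont: "continuous_on A (\<lambda>x. \<eta> (s + x))" "continuous_on A (\<lambda>x. \<eta>' (s + x))" for A
    by (intro continuous_on_shift continuous_eta continuous_eta')+
  \<comment> \<open>The near arc is missed for every positive \<delta> by \<open>off_near\<close>;
    the far arc is compact and omits \<open>\<eta> s\<close>, so it is missed once \<delta> is
    small.\<close>
  have ev_off: "\<forall>\<^sub>F \<delta> in at_right 0. zz \<delta> \<notin> range \<eta>"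
  proof -
    define Far where "Far = (\<lambda>x. \<eta> (s + x)) ` ({-pi..-r} \<union> {r..pi})"
    have "compact Far" unfolding Far_def by (intro compact_continuous_image cont compact_Un) auto
    then have "open (- Far)" by (auto intro: compact_imp_closed)
    moreover have "{-pi..-r} \<union> {r..pi} \<subseteq> {-pi..pi} - {0}" using r by auto
    from img[OF this] have "\<eta> s \<in> - Far" by (simp add: Far_def)
    ultimately have "\<forall>\<^sub>F \<delta> in at_right 0. zz \<delta> \<in> - Far"
      using tozero topological_tendstoD by blast
    moreover have "\<forall>\<^sub>F \<delta> in at_right 0. \<delta> > (0::real)" by (simp add: eventually_at_right_less)
    ultimately show ?thesis
    proof eventually_elim
      case (elim \<delta>)
      show ?case
      proof
        assume "zz \<delta> \<in> range \<eta>"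
        then obtain t where t: "zz \<delta> = \<eta> t" by blast
        obtain n :: int where n: "t - s + pi + 2 * pi * of_int n \<in> {0..<2 * pi}" by (rule reduce_mod_2pi)
        define x where "x = t - s + 2 * pi * of_int n"
        have x: "zz \<delta> = \<eta> (s + x)" "x \<in> {-pi..pi}"
          using n t periodic2pi_add_int[OF periodic, of t n] by (auto simp: x_def)
        show False
        proof (cases "\<bar>x\<bar> \<le> r")
          case True
          then show False using off_near[of x \<delta>] elim x by simp
        next
          case False
          then have "x \<in> {-pi..-r} \<union> {r..pi}" using x(2) by auto
          then show False using elim x(1) unfolding Far_def by blast
        qed
      qed
    qed
  qed
  have split: "W \<delta> = integral {-pi..-\<epsilon>} (k \<delta>) + integral {\<epsilon>..pi} (k \<delta>) + (Ln (u \<delta> \<epsilon>) - Ln (u \<delta> (-\<epsilon>)))"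
    if "zz \<delta> \<notin> range \<eta>" "\<delta> > 0" for \<delta>
  proof -
    have int: "k \<delta> integrable_on {a..b}" for a b
      unfolding k_def using that(1)
      by (intro integrable_continuous_real continuous_intros cont) (metis eq_iff_diff_eq_0 rangeI)
    have "W \<delta> = integral {-pi..pi} (k \<delta>)"
      unfolding W_def k_def
    proof (rule window_integral)
      show "periodic2pi (\<lambda>t. \<eta>' t / (\<eta> t - zz \<delta>))"
        using periodic periodic' by (simp add: periodic2pi_def)
      show "continuous_on UNIV (\<lambda>t. \<eta>' t / (\<eta> t - zz \<delta>))"
        using that(1) by (intro continuous_intros continuous_eta continuous_eta') (metis eq_iff_diff_eq_0 rangeI)
    qed
    also have "\<dots> = integral {-pi..-\<epsilon>} (k \<delta>) + integral {-\<epsilon>..pi} (k \<delta>)"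
      using r by (intro Henstock_Kurzweil_Integration.integral_combine[symmetric] int) auto
    also have "integral {-\<epsilon>..pi} (k \<delta>) = integral {-\<epsilon>..\<epsilon>} (k \<delta>) + integral {\<epsilon>..pi} (k \<delta>)"
      using r by (intro Henstock_Kurzweil_Integration.integral_combine[symmetric] int) auto
    also have "integral {-\<epsilon>..\<epsilon>} (k \<delta>) = Ln (u \<delta> \<epsilon>) - Ln (u \<delta> (-\<epsilon>))"
    proof (intro integral_unique fundamental_theorem_of_calculus)
      fix x assume "x \<in> {-\<epsilon>..\<epsilon>}"
      then have x: "\<bar>x\<bar> \<le> r" using r by (auto simp: abs_le_iff)
      have "(u \<delta> has_vector_derivative (\<i> * \<sigma> * (\<eta>' (s + x) / \<eta>' s))) (at x)"
        unfolding u_def using slope_has_deriv[of s x] by (auto intro!: derivative_eq_intros)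
      from field_vector_diff_chain_at[OF this has_field_derivative_Ln[OF u_near[of x \<delta>]]] x that(2)
      have "((\<lambda>x. Ln (u \<delta> x)) has_vector_derivative (\<i> * \<sigma> * (\<eta>' (s + x) / \<eta>' s) * inverse (u \<delta> x))) (at x)"
        by (simp add: o_def)
      also have "\<i> * \<sigma> * (\<eta>' (s + x) / \<eta>' s) * inverse (u \<delta> x) = k \<delta> x"
      proof -
        have "u \<delta> x \<noteq> 0" using u_near[of x \<delta>] x that by auto
        then show ?thesis
          unfolding k_def u_eq using eta'_nonzero[of s] \<sigma> by (auto simp: field_simps)
      qed
      finally show "((\<lambda>x. Ln (u \<delta> x)) has_vector_derivative k \<delta> x) (at x within {-\<epsilon>..\<epsilon>})"
        by (rule has_vector_derivative_at_within)
    qed (use r in simp)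
    finally show ?thesis by simp
  qed
  \<comment> \<open>Here \<epsilon> stays fixed. The near arc enters only through its endpoints,
    where \<open>u\<close> stays off the cut even at \<open>\<delta> = 0\<close>.\<close>
  have "((\<lambda>\<delta>. integral {-pi..-\<epsilon>} (k \<delta>) + integral {\<epsilon>..pi} (k \<delta>) + (Ln (u \<delta> \<epsilon>) - Ln (u \<delta> (-\<epsilon>)))) \<longlongrightarrow>
      pv_far s \<epsilon> + (Ln (\<i> * \<sigma> * slope s \<epsilon>) - Ln (\<i> * \<sigma> * slope s (-\<epsilon>)))) (at_right 0)"
  proof -
    have "\<i> * \<sigma> * slope s \<epsilon> \<notin> \<real>\<^sub>\<le>\<^sub>0" "\<i> * \<sigma> * slope s (-\<epsilon>) \<notin> \<real>\<^sub>\<le>\<^sub>0"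
      using u_near[of \<epsilon> 0] u_near[of "-\<epsilon>" 0] r by (auto simp: u_def)
    moreover have "((\<lambda>\<delta>. u \<delta> x) \<longlongrightarrow> \<i> * \<sigma> * slope s x) (at_right 0)" for x
    proof -
      have "((\<lambda>\<delta>. u \<delta> x) \<longlongrightarrow> of_real 0 + \<i> * \<sigma> * slope s x) (at_right 0)"
        unfolding u_def by (intro tendsto_intros)
      then show ?thesis by simp
    qed
    moreover have "\<eta> s \<notin> (\<lambda>x. \<eta> (s + x)) ` {-pi..-\<epsilon>}" "\<eta> s \<notin> (\<lambda>x. \<eta> (s + x)) ` {\<epsilon>..pi}"
      by (rule img, use r in force)+
    ultimately show ?thesis
      unfolding pv_far_def k_def
      by (intro tendsto_add tendsto_diff tendsto_Ln cauchy_type_tendsto cont tozero)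
  qed
  then have "(W \<longlongrightarrow> pv_far s \<epsilon> + (Ln (\<i> * \<sigma> * slope s \<epsilon>) - Ln (\<i> * \<sigma> * slope s (-\<epsilon>)))) (at_right 0)"
  proof (rule Lim_transform_eventually)
    have "\<forall>\<^sub>F \<delta> in at_right 0. \<delta> > (0::real)" by (simp add: eventually_at_right_less)
    with ev_off show "\<forall>\<^sub>F \<delta> in at_right 0. integral {-pi..-\<epsilon>} (k \<delta>) + integral {\<epsilon>..pi} (k \<delta>) +
        (Ln (u \<delta> \<epsilon>) - Ln (u \<delta> (-\<epsilon>))) = W \<delta>"
      by eventually_elim (simp add: split)
  qed
  \<comment> \<open>\<open>W\<close> need not be known to be constant: values in a closed set force
    the limit into it.\<close>
  moreover have "\<forall>\<^sub>F \<delta> in at_right 0. W \<delta> \<in> {0, - (2 * pi * \<i>)}"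
    using ev_off by eventually_elim (use winding_integral_values in \<open>simp add: W_def\<close>)
  ultimately show ?thesis
    by (intro Lim_in_closed_set[of "{0, - (2 * pi * \<i>)}" W "at_right 0"]) auto
qed

text \<open>To first order the arguments are \<open>\<i> * \<sigma> * \<epsilon>\<close> and
  \<open>- \<i> * \<sigma> * \<epsilon>\<close>. The real logarithm of \<epsilon> cancels in the
  difference, which leaves \<open>Ln (\<i> * \<sigma>) - Ln (- \<i> * \<sigma>)\<close>.\<close>

lemma log_jump_tendsto:
  assumes "\<sigma> = 1 \<or> \<sigma> = (-1 :: real)"
  shows "((\<lambda>\<epsilon>. Ln (\<i> * \<sigma> * slope s \<epsilon>) - Ln (\<i> * \<sigma> * slope s (-\<epsilon>))) \<longlongrightarrow> \<sigma> * pi * \<i>) (at_right 0)"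
proof -
  define q where "q = (\<lambda>x. slope s x / of_real x)"
  have "filterlim (\<lambda>\<epsilon>::real. \<epsilon>) (at 0) (at_right 0)" "filterlim (\<lambda>\<epsilon>::real. - \<epsilon>) (at 0) (at_right 0)"
    by (auto simp: filterlim_at eventually_at_filter intro!: tendsto_eq_intros)
  from this[THEN slope_tendsto[of _ s]]
  have q: "((\<lambda>\<epsilon>. q \<epsilon>) \<longlongrightarrow> 1) (at_right 0)" "((\<lambda>\<epsilon>. q (- \<epsilon>)) \<longlongrightarrow> 1) (at_right 0)"
    by (auto simp: q_def)
  have "((\<lambda>\<epsilon>. Ln (\<i> * \<sigma> * q \<epsilon>) - Ln (- (\<i> * \<sigma> * q (- \<epsilon>)))) \<longlongrightarrow> Ln (\<i> * \<sigma> * 1) - Ln (- (\<i> * \<sigma> * 1))) (at_right 0)"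
    using assms by (intro tendsto_intros q) (auto simp: complex_nonpos_Reals_iff)
  also have "Ln (\<i> * \<sigma> * 1) - Ln (- (\<i> * \<sigma> * 1)) = \<sigma> * pi * \<i>"
    using assms by auto
  finally have lim: "((\<lambda>\<epsilon>. Ln (\<i> * \<sigma> * q \<epsilon>) - Ln (- (\<i> * \<sigma> * q (- \<epsilon>)))) \<longlongrightarrow> \<sigma> * pi * \<i>) (at_right 0)" .
  have "\<forall>\<^sub>F \<epsilon> in at_right 0. q \<epsilon> \<noteq> 0" "\<forall>\<^sub>F \<epsilon> in at_right 0. q (- \<epsilon>) \<noteq> 0"
    using q by (auto intro: tendsto_imp_eventually_ne)
  moreover have "\<forall>\<^sub>F \<epsilon> in at_right 0. \<epsilon> > (0::real)" by (simp add: eventually_at_right_less)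
  ultimately have "\<forall>\<^sub>F \<epsilon> in at_right 0. Ln (\<i> * \<sigma> * q \<epsilon>) - Ln (- (\<i> * \<sigma> * q (- \<epsilon>))) =
      Ln (\<i> * \<sigma> * slope s \<epsilon>) - Ln (\<i> * \<sigma> * slope s (-\<epsilon>))"
  proof eventually_elim
    case (elim \<epsilon>)
    have "\<i> * \<sigma> * slope s \<epsilon> = of_real \<epsilon> * (\<i> * \<sigma> * q \<epsilon>)"
      "\<i> * \<sigma> * slope s (-\<epsilon>) = of_real \<epsilon> * (- (\<i> * \<sigma> * q (- \<epsilon>)))"
      using elim by (auto simp: q_def)
    moreover have "\<i> * \<sigma> * q \<epsilon> \<noteq> 0" "- (\<i> * \<sigma> * q (- \<epsilon>)) \<noteq> 0" using elim assms by auto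
    ultimately show ?case
      using elim Ln_times_of_real[of \<epsilon> "\<i> * \<sigma> * q \<epsilon>"] Ln_times_of_real[of \<epsilon> "- (\<i> * \<sigma> * q (- \<epsilon>))"]
      by (metis add_diff_cancel_left)
  qed
  with lim show ?thesis by (rule Lim_transform_eventually)
qed

text \<open>For small \<epsilon> the identity \<open>pv_far s \<epsilon> = - J 1 \<epsilon>\<close>
  is exact, so the limit is read off from the logarithms.\<close>

lemma pv_far_tendsto: "(pv_far s \<longlongrightarrow> - (pi * \<i>)) (at_right 0)"
proof -
  obtain r where r: "0 < r" "r \<le> pi" "\<And>x. \<bar>x\<bar> \<le> r \<Longrightarrow> x \<noteq> 0 \<Longrightarrow> Re (slope s x) \<noteq> 0"
    using slope_near by metis
  define J where "J = (\<lambda>(\<sigma>::real) \<epsilon>. Ln (\<i> * \<sigma> * slope s \<epsilon>) - Ln (\<i> * \<sigma> * slope s (-\<epsilon>)))"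
  have J: "(J 1 \<longlongrightarrow> pi * \<i>) (at_right 0)" "(J (-1) \<longlongrightarrow> - (pi * \<i>)) (at_right 0)"
    using log_jump_tendsto[of 1 s] log_jump_tendsto[of "-1" s] by (simp_all add: J_def)
  have "((\<lambda>\<epsilon>. J 1 \<epsilon> - J (-1) \<epsilon>) \<longlongrightarrow> pi * \<i> - - (pi * \<i>)) (at_right 0)"
    by (intro tendsto_diff J)
  then have "\<forall>\<^sub>F \<epsilon> in at_right 0. dist (J 1 \<epsilon> - J (-1) \<epsilon>) (pi * \<i> - - (pi * \<i>)) < 1"
    by (rule tendstoD) simp
  moreover have "\<forall>\<^sub>F \<epsilon> in at_right 0. \<epsilon> > (0::real)" by (simp add: eventually_at_right_less)
  moreover have "\<forall>\<^sub>F \<epsilon> in at_right 0. \<epsilon> < r"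
    using r(1) by (auto simp: eventually_at_right_field)
  ultimately have "\<forall>\<^sub>F \<epsilon> in at_right 0. - J 1 \<epsilon> = pv_far s \<epsilon>"
  proof eventually_elim
    case (elim \<epsilon>)
    have "pv_far s \<epsilon> + J 1 \<epsilon> \<in> {0, - (2 * pi * \<i>)}" "pv_far s \<epsilon> + J (-1) \<epsilon> \<in> {0, - (2 * pi * \<i>)}"
      unfolding J_def by (rule winding_normal_limit[of \<epsilon> r]; use elim r in auto)+
    moreover have "\<bar>Im (J 1 \<epsilon> - J (-1) \<epsilon>) - 2 * pi\<bar> < 1"
      using elim(1) abs_Im_le_cmod[of "J 1 \<epsilon> - J (-1) \<epsilon> - (pi * \<i> - - (pi * \<i>))"]
      by (simp add: dist_norm)
    moreover have "Im (J 1 \<epsilon> - J (-1) \<epsilon>) = Im (pv_far s \<epsilon> + J 1 \<epsilon>) - Im (pv_far s \<epsilon> + J (-1) \<epsilon>)" by simp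
    \<comment> \<open>The imaginary parts of the two sums differ by 0 or by 2 pi in modulus; a
      difference within 1 of 2 pi leaves only 0 and -2 pi, in this order.\<close>
    ultimately have "pv_far s \<epsilon> + J 1 \<epsilon> = 0"
      using pi_gt3 by (auto simp del: minus_complex.sel plus_complex.sel)
    then show ?case by (simp add: add_eq_0_iff)
  qed
  moreover have "((\<lambda>\<epsilon>. - J 1 \<epsilon>) \<longlongrightarrow> - (pi * \<i>)) (at_right 0)" by (intro tendsto_minus J)
  ultimately show ?thesis by (rule Lim_transform_eventually[rotated])
qed

section \<open>The principal value for Hoelder densities\<close>

lemma punctured_window:
  assumes "0 < \<epsilon>" "\<epsilon> < pi"
  shows "{s - pi..s + pi} - {s - \<epsilon><..<s + \<epsilon>} = {s - pi..s - \<epsilon>} \<union> {s + \<epsilon>..s + pi}"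
  using assms by auto

lemma punctured_integrable:
  assumes "hoelder2pi \<psi>" "0 < \<epsilon>" "\<epsilon> < pi"
  shows "(\<lambda>t. \<psi> t * \<eta>' t / (\<eta> t - \<eta> s)) integrable_on {s - pi..s - \<epsilon>}"
    "(\<lambda>t. \<psi> t * \<eta>' t / (\<eta> t - \<eta> s)) integrable_on {s + \<epsilon>..s + pi}"
    "(\<lambda>t. \<psi> t * \<eta>' t / (\<eta> t - \<eta> s)) integrable_on ({s - pi..s + pi} - {s - \<epsilon><..<s + \<epsilon>})"
proof -
  have nz: "\<eta> t - \<eta> s \<noteq> 0" if "t \<in> {s - pi..s + pi} - {s - \<epsilon><..<s + \<epsilon>}" for t
    using nearest_nonzero[OF nearest_self, of "t - s" s] that assms(2) by force
  then have *: "(\<lambda>t. \<psi> t * \<eta>' t / (\<eta> t - \<eta> s)) integrable_on {a..b}"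
    if "{a..b} \<subseteq> {s - pi..s + pi} - {s - \<epsilon><..<s + \<epsilon>}" for a b
    using that by (intro integrable_continuous_real continuous_intros continuous_eta continuous_eta'
        hoelder2pi_continuous[OF assms(1)]) auto
  show 1: "(\<lambda>t. \<psi> t * \<eta>' t / (\<eta> t - \<eta> s)) integrable_on {s - pi..s - \<epsilon>}"
    "(\<lambda>t. \<psi> t * \<eta>' t / (\<eta> t - \<eta> s)) integrable_on {s + \<epsilon>..s + pi}"
    by (rule *; use assms in auto)+
  show "(\<lambda>t. \<psi> t * \<eta>' t / (\<eta> t - \<eta> s)) integrable_on ({s - pi..s + pi} - {s - \<epsilon><..<s + \<epsilon>})"
    unfolding punctured_window[OF assms(2,3)] using assms by (intro integrable_Un 1) auto
qed

text \<open>The subtracted part is integrable, so its truncations converge by continuity of the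
  indefinite integral; what remains is \<open>\<psi> s\<close> times \<open>pv_far\<close>.\<close>

lemma principal_value:
  assumes "hoelder2pi \<psi>"
  shows "((\<lambda>\<epsilon>. integral ({s - pi..s + pi} - {s - \<epsilon><..<s + \<epsilon>}) (\<lambda>t. \<psi> t * \<eta>' t / (\<eta> t - \<eta> s))) \<longlongrightarrow>
    cauchy_diff_int \<psi> s - pi * \<i> * \<psi> s) (at_right 0)"
proof -
  let ?c = "cauchy_diff \<psi> s (\<eta> s)"
  let ?k = "\<lambda>x. \<eta>' (s + x) / (\<eta> (s + x) - \<eta> s)"
  have int: "?c integrable_on {-pi..pi}" by (rule cauchy_diff_integrable[OF assms nearest_self])
  have to0: "((\<lambda>\<epsilon>. integral {-pi..-\<epsilon>} ?c) \<longlongrightarrow> integral {-pi..0} ?c) (at_right 0)"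
    "((\<lambda>\<epsilon>. integral {\<epsilon>..pi} ?c) \<longlongrightarrow> integral {0..pi} ?c) (at_right 0)"
  proof -
    have "isCont (\<lambda>x. integral {-pi..x} ?c) 0" "isCont (\<lambda>x. integral {x..pi} ?c) 0"
      using indefinite_integral_continuous_1[OF int] indefinite_integral_continuous_1'[OF int] pi_gt_zero
      by (auto intro!: continuous_on_interior)
    moreover have "((\<lambda>\<epsilon>::real. - \<epsilon>) \<longlongrightarrow> 0) (at_right 0)" "((\<lambda>\<epsilon>::real. \<epsilon>) \<longlongrightarrow> 0) (at_right 0)"
      by (auto intro!: tendsto_eq_intros)
    ultimately show "((\<lambda>\<epsilon>. integral {-pi..-\<epsilon>} ?c) \<longlongrightarrow> integral {-pi..0} ?c) (at_right 0)"
      "((\<lambda>\<epsilon>. integral {\<epsilon>..pi} ?c) \<longlongrightarrow> integral {0..pi} ?c) (at_right 0)"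
      by (auto intro: isCont_tendsto_compose)
  qed
  have "integral {-pi..0} ?c + integral {0..pi} ?c = cauchy_diff_int \<psi> s"
    unfolding cauchy_diff_int_def by (rule Henstock_Kurzweil_Integration.integral_combine[OF _ _ int]) auto
  then have "((\<lambda>\<epsilon>. (integral {-pi..-\<epsilon>} ?c + integral {\<epsilon>..pi} ?c) + \<psi> s * pv_far s \<epsilon>) \<longlongrightarrow>
      cauchy_diff_int \<psi> s + \<psi> s * - (pi * \<i>)) (at_right 0)"
    using tendsto_add[OF to0] by (intro tendsto_add tendsto_mult tendsto_const pv_far_tendsto) simp
  then have lim: "((\<lambda>\<epsilon>. (integral {-pi..-\<epsilon>} ?c + integral {\<epsilon>..pi} ?c) + \<psi> s * pv_far s \<epsilon>) \<longlongrightarrow>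
      cauchy_diff_int \<psi> s - pi * \<i> * \<psi> s) (at_right 0)"
    by (simp add: mult.commute)
  have "\<forall>\<^sub>F \<epsilon> in at_right 0. \<epsilon> > (0::real)" by (simp add: eventually_at_right_less)
  moreover have "\<forall>\<^sub>F \<epsilon> in at_right 0. \<epsilon> < pi"
    unfolding eventually_at_right_field using pi_gt_zero by blast
  ultimately have "\<forall>\<^sub>F \<epsilon> in at_right 0.
      (integral {-pi..-\<epsilon>} ?c + integral {\<epsilon>..pi} ?c) + \<psi> s * pv_far s \<epsilon> =
      integral ({s - pi..s + pi} - {s - \<epsilon><..<s + \<epsilon>}) (\<lambda>t. \<psi> t * \<eta>' t / (\<eta> t - \<eta> s))"
  proof eventually_elim
    case (elim \<epsilon>)
    have piece: "integral {s + a..s + b} (\<lambda>t. \<psi> t * \<eta>' t / (\<eta> t - \<eta> s)) = integral {a..b} ?c + \<psi> s * integral {a..b} ?k"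
      if ab: "{a..b} \<subseteq> {-pi..pi} - {0}" for a b
    proof -
      have nz: "\<eta> (s + x) - \<eta> s \<noteq> 0" if "x \<in> {a..b}" for x
      proof -
        have "x \<in> {-pi..pi} - {0}" using that ab by blast
        from nearest_nonzero[OF nearest_self this, of s] show ?thesis by simp
      qed
      have cont: "continuous_on {a..b} (\<lambda>x. \<eta> (s + x))" "continuous_on {a..b} (\<lambda>x. \<eta>' (s + x))"
        by (intro continuous_on_shift continuous_eta continuous_eta')+
      have "integral {s + a..s + b} (\<lambda>t. \<psi> t * \<eta>' t / (\<eta> t - \<eta> s)) =
          integral {a..b} (\<lambda>x. \<psi> (s + x) * \<eta>' (s + x) / (\<eta> (s + x) - \<eta> s))"
        using integral_shift_real_ivl[of "s + a" s "s + b" "\<lambda>t. \<psi> t * \<eta>' t / (\<eta> t - \<eta> s)"]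
        by (simp add: add.commute)
      also have "\<dots> = integral {a..b} (\<lambda>x. ?c x + \<psi> s * ?k x)"
        by (simp add: cauchy_diff_def left_diff_distrib diff_divide_distrib)
      also have "\<dots> = integral {a..b} ?c + integral {a..b} (\<lambda>x. \<psi> s * ?k x)"
      proof (rule integral_add)
        show "?c integrable_on {a..b}" by (rule integrable_subinterval_real[OF int]) (use ab in blast)
        show "(\<lambda>x. \<psi> s * ?k x) integrable_on {a..b}"
          using nz by (intro integrable_continuous_real continuous_intros cont) blast
      qed
      finally show ?thesis by (simp only: integral_mult_right)
    qed
    have "integral ({s - pi..s + pi} - {s - \<epsilon><..<s + \<epsilon>}) (\<lambda>t. \<psi> t * \<eta>' t / (\<eta> t - \<eta> s)) =
        integral {s - pi..s - \<epsilon>} (\<lambda>t. \<psi> t * \<eta>' t / (\<eta> t - \<eta> s)) +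
        integral {s + \<epsilon>..s + pi} (\<lambda>t. \<psi> t * \<eta>' t / (\<eta> t - \<eta> s))"
      unfolding punctured_window[OF elim]
      using punctured_integrable(1,2)[OF assms elim] elim by (intro integral_Un) auto
    also have "\<dots> = integral {-pi..-\<epsilon>} ?c + integral {\<epsilon>..pi} ?c + \<psi> s * pv_far s \<epsilon>"
    proof -
      have "{-pi..-\<epsilon>} \<subseteq> {-pi..pi} - {0}" "{\<epsilon>..pi} \<subseteq> {-pi..pi} - {0}" using elim by auto
      from this[THEN piece] show ?thesis by (simp add: pv_far_def distrib_left)
    qed
    finally show ?case by simp
  qed
  with lim show ?thesis by (rule Lim_transform_eventually)
qed

end

subsection \<open>Systems of curves\<close>

definition cauchy_int :: "(real \<Rightarrow> complex) \<Rightarrow> (real \<Rightarrow> complex) \<Rightarrow> complex \<Rightarrow> complex" where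
  "cauchy_int \<eta> \<psi> z = integral {0..2 * pi} (\<lambda>t. \<psi> t * vector_derivative \<eta> (at t) / (\<eta> t - z))"

lemma hoelder2pi_Im:
  assumes "hoelder2pi f"
  shows "hoelder2pi (\<lambda>t. complex_of_real (Im (f t)))"
proof -
  obtain C \<alpha> where C: "0 < \<alpha>" "\<alpha> \<le> 1"
    "\<And>s t. \<bar>s - t\<bar> \<le> 2 * pi \<Longrightarrow> norm (f s - f t) \<le> C * \<bar>s - t\<bar> powr \<alpha>"
    and per: "periodic2pi f"
    using assms unfolding hoelder2pi_def by blast
  show ?thesis
  proof (rule hoelder2piI[OF _ C(1,2), of _ C])
    show "periodic2pi (\<lambda>t. complex_of_real (Im (f t)))" using per by (simp add: periodic2pi_def)
    fix s t :: real assume "\<bar>s - t\<bar> \<le> 2 * pi"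
    then have "\<bar>Im (f s - f t)\<bar> \<le> C * \<bar>s - t\<bar> powr \<alpha>"
      using abs_Im_le_cmod[of "f s - f t"] C(3)[of s t] by linarith
    then show "norm (complex_of_real (Im (f s)) - complex_of_real (Im (f t))) \<le> C * \<bar>s - t\<bar> powr \<alpha>"
      by (metis minus_complex.sel(2) norm_of_real of_real_diff)
  qed
qed

lemma hoelder2pi_quotient:
  assumes "admissible_A m A" "in_H m u" "k < m"
  shows "hoelder2pi (\<lambda>t. of_real (u k t) / A k t)"
proof -
  have "hoelder2pi (\<lambda>t. of_real (u k t) * inverse (A k t))"
    using assms unfolding admissible_A_def in_H_def
    by (intro hoelder2pi_mult hoelder2pi_of_real hoelder2pi_inverse C1_periodic_hoelder2pi) auto
  then show ?thesis by (simp add: divide_inverse)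
qed

context C2_loop
begin

lemma cauchy_int_eq: "cauchy_int \<eta> \<psi> z = integral {0..2 * pi} (\<lambda>t. \<psi> t * \<eta>' t / (\<eta> t - z))"
  by (simp add: cauchy_int_def \<eta>'_def)

lemma cauchy_int_holomorphic:
  assumes "hoelder2pi \<psi>"
  shows "cauchy_int \<eta> \<psi> holomorphic_on - range \<eta>"
proof -
  have "(\<lambda>z. integral {0..2 * pi} (\<lambda>t. \<psi> t * \<eta>' t / (\<eta> t - z))) holomorphic_on - (\<eta> ` {0..2 * pi})"
    by (intro cauchy_type_holomorphic continuous_intros continuous_eta continuous_eta'
        hoelder2pi_continuous[OF assms])
  then have "(\<lambda>z. integral {0..2 * pi} (\<lambda>t. \<psi> t * \<eta>' t / (\<eta> t - z))) holomorphic_on - range \<eta>"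
    by (rule holomorphic_on_subset) auto
  then show ?thesis by (simp add: cauchy_int_eq[abs_def])
qed

lemma cauchy_diff_int_linear:
  assumes "hoelder2pi f" "hoelder2pi g"
  shows "cauchy_diff_int (\<lambda>t. f t + c * g t) s = cauchy_diff_int f s + c * cauchy_diff_int g s"
proof -
  have "cauchy_diff (\<lambda>t. f t + c * g t) s (\<eta> s) = (\<lambda>x. cauchy_diff f s (\<eta> s) x + c * cauchy_diff g s (\<eta> s) x)"
    by (rule ext) (simp add: cauchy_diff_def ring_distribs add_divide_distrib diff_divide_distrib mult.assoc)
  moreover have "integral {-pi..pi} (\<lambda>x. cauchy_diff f s (\<eta> s) x + c * cauchy_diff g s (\<eta> s) x) =
      integral {-pi..pi} (cauchy_diff f s (\<eta> s)) + integral {-pi..pi} (\<lambda>x. c * cauchy_diff g s (\<eta> s) x)"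
    by (intro integral_add integrable_on_mult_right cauchy_diff_integrable nearest_self assms)
  ultimately show ?thesis by (simp add: cauchy_diff_int_def)
qed

lemma cauchy_int_linear:
  assumes "hoelder2pi f" "hoelder2pi g" "z \<notin> range \<eta>"
  shows "cauchy_int \<eta> (\<lambda>t. f t + c * g t) z = cauchy_int \<eta> f z + c * cauchy_int \<eta> g z"
proof -
  have int: "(\<lambda>t. h t * \<eta>' t / (\<eta> t - z)) integrable_on {0..2 * pi}" if "hoelder2pi h" for h
    using assms(3) by (intro integrable_continuous_real continuous_intros continuous_eta continuous_eta'
        hoelder2pi_continuous[OF that]) (metis eq_iff_diff_eq_0 rangeI)
  have "cauchy_int \<eta> (\<lambda>t. f t + c * g t) z =
      integral {0..2 * pi} (\<lambda>t. f t * \<eta>' t / (\<eta> t - z) + c * (g t * \<eta>' t / (\<eta> t - z)))"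
    by (simp add: cauchy_int_eq ring_distribs add_divide_distrib mult.assoc)
  also have "\<dots> = cauchy_int \<eta> f z + integral {0..2 * pi} (\<lambda>t. c * (g t * \<eta>' t / (\<eta> t - z)))"
    unfolding cauchy_int_eq by (intro integral_add integrable_on_mult_right int assms)
  also have "integral {0..2 * pi} (\<lambda>t. c * (g t * \<eta>' t / (\<eta> t - z))) = c * cauchy_int \<eta> g z"
    unfolding cauchy_int_eq by (rule integral_mult_right)
  finally show ?thesis .
qed

text \<open>Meant for the contributions of the other curves, which are holomorphic near this one and
  therefore C1 along it.\<close>

lemma hoelder2pi_holomorphic_compose:
  assumes "f holomorphic_on S" "open S" "range \<eta> \<subseteq> S"
  shows "hoelder2pi (\<lambda>s. f (\<eta> s))"
proof (rule C1_periodic_hoelder2pi)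
  show "periodic2pi (\<lambda>s. f (\<eta> s))" using periodic by (simp add: periodic2pi_def)
  have "((\<lambda>s. f (\<eta> s)) has_vector_derivative (\<eta>' s * deriv f (\<eta> s))) (at s)" for s
  proof -
    have "(f has_field_derivative deriv f (\<eta> s)) (at (\<eta> s))"
      using assms by (intro holomorphic_derivI[of f S]) auto
    from field_vector_diff_chain_at[OF has_deriv this] show ?thesis by (simp add: o_def)
  qed
  moreover have "continuous_on UNIV (\<lambda>s. \<eta>' s * deriv f (\<eta> s))"
  proof -
    have "continuous_on S (deriv f)"
      using assms by (intro holomorphic_on_imp_continuous_on holomorphic_deriv)
    from continuous_on_compose2[OF this continuous_eta assms(3)]
    show ?thesis by (intro continuous_intros continuous_eta')
  qed
  ultimately show "C1_fun (\<lambda>s. f (\<eta> s))"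
    unfolding C1_fun_def by (intro exI[of _ "\<lambda>s. \<eta>' s * deriv f (\<eta> s)"]) simp
qed

end

text \<open>By \<open>C2_loop.principal_value\<close> this is the principal value, at the point \<open>eta j s\<close>, of the Cauchy
  integral with density \<open>\<psi>\<close> over all curves.\<close>

definition pv_cauchy :: "nat \<Rightarrow> (nat \<Rightarrow> real \<Rightarrow> complex) \<Rightarrow> (nat \<Rightarrow> real \<Rightarrow> complex) \<Rightarrow> nat \<Rightarrow> real \<Rightarrow> complex" where
  "pv_cauchy m eta \<psi> j s = (\<Sum>k<m. if k = j then C2_loop.cauchy_diff_int (eta j) (\<psi> j) s - pi * \<i> * \<psi> j s
     else cauchy_int (eta k) (\<psi> k) (eta j s))"

locale curve_system =
  fixes m :: nat and eta :: "nat \<Rightarrow> real \<Rightarrow> complex"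
  assumes admissible: "admissible_curves m eta"
begin

lemma loop: "k < m \<Longrightarrow> C2_loop (eta k)"
  using admissible unfolding admissible_curves_def cpath_def by unfold_locales auto

lemma image_eq: "k < m \<Longrightarrow> path_image (cpath eta k) = range (eta k)"
  using C2_loop.path_image_eq[OF loop] by (simp add: cpath_def)

lemma separated:
  assumes "j < m" "k < m" "j \<noteq> k"
  shows "(range (eta j) \<union> inside (range (eta j))) \<inter> (range (eta k) \<union> inside (range (eta k))) = {}"
  using admissible assms unfolding admissible_curves_def by (simp add: image_eq)

lemma off_other_curve:
  assumes "j < m" "k < m" "k \<noteq> j"
  shows "eta j s \<notin> range (eta k)"
  using separated[OF assms(1,2)] assms(3) by blast

text \<open>With \<open>c = \<i>\<close> this separates the densities \<gamma>/A and \<mu>/A, on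
  which the real operators act.\<close>

lemma pv_cauchy_linear:
  assumes "j < m" "\<And>k. k < m \<Longrightarrow> hoelder2pi (f k)" "\<And>k. k < m \<Longrightarrow> hoelder2pi (g k)"
  shows "pv_cauchy m eta (\<lambda>k t. f k t + c * g k t) j s = pv_cauchy m eta f j s + c * pv_cauchy m eta g j s"
  unfolding pv_cauchy_def sum_distrib_left sum.distrib[symmetric]
proof (rule sum.cong[OF refl])
  fix k assume "k \<in> {..<m}"
  then have k: "k < m" by simp
  show "(if k = j then C2_loop.cauchy_diff_int (eta j) (\<lambda>t. f j t + c * g j t) s - pi * \<i> * (f j s + c * g j s)
      else cauchy_int (eta k) (\<lambda>t. f k t + c * g k t) (eta j s)) =
    (if k = j then C2_loop.cauchy_diff_int (eta j) (f j) s - pi * \<i> * f j s else cauchy_int (eta k) (f k) (eta j s)) +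
    c * (if k = j then C2_loop.cauchy_diff_int (eta j) (g j) s - pi * \<i> * g j s else cauchy_int (eta k) (g k) (eta j s))"
    using C2_loop.cauchy_diff_int_linear[OF loop[OF assms(1)] assms(2,3)[OF assms(1)], of c s]
      C2_loop.cauchy_int_linear[OF loop[OF k] assms(2,3)[OF k] off_other_curve[OF assms(1) k], of c]
    by (simp add: algebra_simps)
qed

lemma pv_cauchy_hoelder:
  assumes "j < m" "\<And>k. k < m \<Longrightarrow> hoelder2pi (\<psi> k)"
  shows "hoelder2pi (pv_cauchy m eta \<psi> j)"
proof -
  have "hoelder2pi (\<lambda>s. if k = j then C2_loop.cauchy_diff_int (eta j) (\<psi> j) s - pi * \<i> * \<psi> j s
      else cauchy_int (eta k) (\<psi> k) (eta j s))" if "k < m" for k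
  proof (cases "k = j")
    case True
    have "hoelder2pi (\<lambda>s. C2_loop.cauchy_diff_int (eta j) (\<psi> j) s + (- (pi * \<i>)) * \<psi> j s)"
      by (intro hoelder2pi_add hoelder2pi_mult hoelder2pi_const C2_loop.hoelder2pi_cauchy_diff_int loop assms)
    with True show ?thesis by simp
  next
    case False
    have "hoelder2pi (\<lambda>s. cauchy_int (eta k) (\<psi> k) (eta j s))"
    proof (rule C2_loop.hoelder2pi_holomorphic_compose[OF loop[OF assms(1)]])
      show "cauchy_int (eta k) (\<psi> k) holomorphic_on - range (eta k)"
        by (rule C2_loop.cauchy_int_holomorphic[OF loop[OF that] assms(2)[OF that]])
      show "open (- range (eta k))" using C2_loop.closed_range[OF loop[OF that]] by auto
      show "range (eta j) \<subseteq> - range (eta k)" using off_other_curve[OF assms(1) that False] by auto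
    qed
    with False show ?thesis by simp
  qed
  then show ?thesis unfolding pv_cauchy_def by (intro hoelder2pi_sum) auto
qed

text \<open>\<open>P\<close> is \<open>Re\<close> or \<open>Im\<close>, so that M and N are handled
  together: a bounded real-linear map commutes with integrals and limits. The complex factor
  \<open>A j s / pi\<close> must stay inside \<open>P\<close>.\<close>

lemma int_op_kernel:
  fixes P :: "complex \<Rightarrow> real"
  assumes P: "bounded_linear P" and A: "admissible_A m A" and u: "in_H m u" and j: "j < m"
  shows "int_op (\<lambda>j s k t. P (kernelMN eta A j s k t)) m u j s =
    P (A j s / pi * pv_cauchy m eta (\<lambda>k t. of_real (u k t) / A k t) j s)"
proof -
  interpret P: bounded_linear P by (rule P)
  define \<psi> where "\<psi> = (\<lambda>k t. complex_of_real (u k t) / A k t)"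
  define c where "c = A j s / complex_of_real pi"
  define g where "g = (\<lambda>k t. \<psi> k t * vector_derivative (eta k) (at t) / (eta k t - eta j s))"
  have \<psi>: "hoelder2pi (\<psi> k)" if "k < m" for k
    unfolding \<psi>_def by (rule hoelder2pi_quotient[OF A u that])
  \<comment> \<open>The density \<open>u\<close> is real, so it passes through \<open>P\<close> as a
    scalar and can join \<open>1 / A\<close> to form \<psi>.\<close>
  have ker: "P (kernelMN eta A j s k t) * u k t = P (c * g k t)" for k t
  proof -
    have "P (kernelMN eta A j s k t) * u k t = P (u k t *\<^sub>R kernelMN eta A j s k t)"
      by (simp add: P.scaleR mult.commute)
    also have "u k t *\<^sub>R kernelMN eta A j s k t = c * g k t"
      by (simp add: kernelMN_def c_def g_def \<psi>_def scaleR_conv_of_real ac_simps)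
    finally show ?thesis .
  qed
  have Pint: "integral X (\<lambda>t. P (c * g k t)) = P (c * integral X (g k))" if "g k integrable_on X" for X k
  proof -
    have "bounded_linear (\<lambda>z. P (c * z))" by (rule bounded_linear_compose[OF P bounded_linear_mult_right])
    from integral_linear[OF that this] show ?thesis by (simp add: o_def)
  qed
  have diag: "Lim (at_right 0) (\<lambda>\<epsilon>. integral ({s - pi..s + pi} - {s - \<epsilon><..<s + \<epsilon>}) (\<lambda>t. P (c * g j t))) =
      P (c * (C2_loop.cauchy_diff_int (eta j) (\<psi> j) s - pi * \<i> * \<psi> j s))"
  proof -
    interpret L: C2_loop "eta j" by (rule loop[OF j])
    have gj: "g j = (\<lambda>t. \<psi> j t * L.\<eta>' t / (eta j t - eta j s))" by (simp add: g_def L.\<eta>'_def)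
    have "((\<lambda>\<epsilon>. P (c * integral ({s - pi..s + pi} - {s - \<epsilon><..<s + \<epsilon>}) (g j))) \<longlongrightarrow>
        P (c * (L.cauchy_diff_int (\<psi> j) s - pi * \<i> * \<psi> j s))) (at_right 0)"
      unfolding gj by (intro P.tendsto tendsto_mult_left L.principal_value \<psi> j)
    moreover have "\<forall>\<^sub>F \<epsilon> in at_right 0. P (c * integral ({s - pi..s + pi} - {s - \<epsilon><..<s + \<epsilon>}) (g j)) =
        integral ({s - pi..s + pi} - {s - \<epsilon><..<s + \<epsilon>}) (\<lambda>t. P (c * g j t))"
    proof -
      have "\<forall>\<^sub>F \<epsilon> in at_right 0. \<epsilon> > (0::real)" by (simp add: eventually_at_right_less)
      moreover have "\<forall>\<^sub>F \<epsilon> in at_right 0. \<epsilon> < pi"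
        unfolding eventually_at_right_field using pi_gt_zero by blast
      ultimately show ?thesis
        by eventually_elim (rule Pint[symmetric], unfold gj, rule L.punctured_integrable(3)[OF \<psi>[OF j]])
    qed
    ultimately show ?thesis
      by (intro tendsto_Lim) (auto intro: Lim_transform_eventually)
  qed
  have off: "integral {0..2 * pi} (\<lambda>t. P (c * g k t)) = P (c * cauchy_int (eta k) (\<psi> k) (eta j s))"
    if "k < m" "k \<noteq> j" for k
  proof -
    interpret L: C2_loop "eta k" by (rule loop[OF that(1)])
    have "g k integrable_on {0..2 * pi}"
      unfolding g_def L.\<eta>'_def[symmetric] using off_other_curve[OF j that]
      by (intro integrable_continuous_real continuous_intros L.continuous_eta L.continuous_eta'
          hoelder2pi_continuous[OF \<psi>[OF that(1)]]) (metis eq_iff_diff_eq_0 rangeI)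
    then show ?thesis by (simp add: Pint) (simp add: g_def cauchy_int_def)
  qed
  have "int_op (\<lambda>j s k t. P (kernelMN eta A j s k t)) m u j s =
      (\<Sum>k<m. P (c * (if k = j then C2_loop.cauchy_diff_int (eta j) (\<psi> j) s - pi * \<i> * \<psi> j s
         else cauchy_int (eta k) (\<psi> k) (eta j s))))"
    unfolding int_op_def ker by (rule sum.cong[OF refl]) (use diag off in auto)
  also have "\<dots> = P (c * pv_cauchy m eta \<psi> j s)"
    unfolding pv_cauchy_def sum_distrib_left P.sum ..
  finally show ?thesis by (simp add: c_def \<psi>_def)
qed

text \<open>Only the j-th curve contributes a jump; the other integrals are continuous at
  \<open>eta j s\<close>. The term \<open>pi * \<i> * \<psi> j s\<close> undoes the subtraction
  contained in \<open>pv_cauchy\<close>.\<close>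

lemma cauchy_sum_boundary_limit:
  assumes "j < m" "\<And>k. k < m \<Longrightarrow> hoelder2pi (\<psi> k)" "S \<inter> range (eta j) = {}"
    "\<And>z. z \<in> S \<Longrightarrow> integral {0..2 * pi} (\<lambda>t. C2_loop.\<eta>' (eta j) t / (eta j t - z)) = w"
  shows "((\<lambda>z. \<Sum>k<m. cauchy_int (eta k) (\<psi> k) z) \<longlongrightarrow>
    pv_cauchy m eta \<psi> j s + pi * \<i> * \<psi> j s + \<psi> j s * w) (at (eta j s) within S)"
proof -
  define lim where "lim = (\<lambda>k. if k = j then C2_loop.cauchy_diff_int (eta j) (\<psi> j) s + \<psi> j s * w
      else cauchy_int (eta k) (\<psi> k) (eta j s))"
  have "(cauchy_int (eta k) (\<psi> k) \<longlongrightarrow> lim k) (at (eta j s) within S)" if k: "k < m" for k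
  proof (cases "k = j")
    case True
    interpret L: C2_loop "eta j" by (rule loop[OF assms(1)])
    show ?thesis
      using True L.plemelj[OF assms(2)[OF assms(1)] assms(3,4), of s]
      by (simp add: lim_def L.cauchy_int_eq[abs_def])
  next
    case False
    interpret L: C2_loop "eta k" by (rule loop[OF k])
    have "isCont (cauchy_int (eta k) (\<psi> k)) (eta j s)"
      using holomorphic_on_imp_continuous_on[OF L.cauchy_int_holomorphic[OF assms(2)[OF k]]]
        L.closed_range off_other_curve[OF assms(1) k False, of s]
      by (auto simp: continuous_on_eq_continuous_at open_Compl)
    then show ?thesis
      using False by (auto simp: lim_def isCont_def intro: tendsto_within_subset)
  qed
  then have "((\<lambda>z. \<Sum>k<m. cauchy_int (eta k) (\<psi> k) z) \<longlongrightarrow> (\<Sum>k<m. lim k)) (at (eta j s) within S)"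
    by (intro tendsto_sum) auto
  moreover have "(\<Sum>k<m. lim k) = pv_cauchy m eta \<psi> j s + pi * \<i> * \<psi> j s + \<psi> j s * w"
  proof -
    have "(\<Sum>k<m. lim k) = (\<Sum>k<m. (if k = j then C2_loop.cauchy_diff_int (eta j) (\<psi> j) s - pi * \<i> * \<psi> j s
       else cauchy_int (eta k) (\<psi> k) (eta j s)) + (if k = j then pi * \<i> * \<psi> j s + \<psi> j s * w else 0))"
      by (rule sum.cong) (auto simp: lim_def)
    then show ?thesis using assms(1) by (simp add: sum.distrib pv_cauchy_def sum.delta)
  qed
  ultimately show ?thesis by simp
qed

section \<open>The regions on the two sides of the curves\<close>

lemma Gminus_eq: "Gminus m eta = (\<Union>k<m. inside (range (eta k)))"
  by (simp add: Gminus_def image_eq)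

lemma open_Gminus: "open (Gminus m eta)"
  unfolding Gminus_eq using C2_loop.closed_range[OF loop] by (auto intro!: open_inside)

lemma Gminus_off_curves:
  assumes "k < m" shows "Gminus m eta \<subseteq> - range (eta k)"
proof
  fix z assume "z \<in> Gminus m eta"
  then obtain i where i: "i < m" "z \<in> inside (range (eta i))" unfolding Gminus_eq by blast
  show "z \<in> - range (eta k)"
  proof (cases "i = k")
    case True
    then show ?thesis using i inside_no_overlap by blast
  next
    case False
    then show ?thesis using separated[OF i(1) assms False] i(2) by blast
  qed
qed

lemma Gregion_outside:
  assumes "z \<in> Gregion m eta" "j < m"
  shows "z \<in> outside (range (eta j))"
proof -
  have "z \<notin> range (eta j)" "z \<notin> inside (range (eta j))"
    using assms unfolding Gregion_def Gamma_bd_def Gminus_eq by (auto simp: image_eq)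
  then show ?thesis using inside_Un_outside[of "range (eta j)"] by blast
qed

text \<open>The other curves together with their insides form a closed set that misses
  \<open>eta j s\<close>. The localization matters because the winding integral about the j-th curve
  is -2 pi i only inside that curve, not on all of G^-.\<close>

lemma at_within_Gminus:
  assumes j: "j < m"
  shows "at (eta j s) within Gminus m eta = at (eta j s) within inside (range (eta j))"
proof (rule at_within_nhd)
  define V where "V = - (\<Union>k\<in>{..<m} - {j}. range (eta k) \<union> inside (range (eta k)))"
  show "eta j s \<in> V" unfolding V_def using separated[OF j] by blast
  have "closed (range (eta k) \<union> inside (range (eta k)))" if "k < m" for k
    using closed_path_image_Un_inside[of "cpath eta k"] admissible that image_eq[OF that]
    unfolding admissible_curves_def by (simp add: simple_path_imp_path)
  then show "open V" unfolding V_def by (intro open_Compl closed_UN) auto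
  show "Gminus m eta \<inter> V - {eta j s} = inside (range (eta j)) \<inter> V - {eta j s}"
    unfolding V_def Gminus_eq using j by blast
qed

end

section \<open>The jump relations combined with the integral equation\<close>

theorem theorem3p4:
  fixes m :: nat
    and eta A :: "nat \<Rightarrow> real \<Rightarrow> complex"
    and \<gamma> \<mu> :: "nat \<Rightarrow> real \<Rightarrow> real"
  assumes "m \<ge> 1"
    and "admissible_curves m eta"
    and "connected (Gregion m eta)"
    and "0 \<in> Gregion m eta"
    and "admissible_A m A"
    and "in_H m \<gamma>"
    and "in_H m \<mu>"
    and "\<forall>j<m. \<forall>s\<in>{0..2 * pi}.
           \<mu> j s - int_op (kN eta A) m \<mu> j s = - int_op (kM eta A) m \<gamma> j s"
  shows "in_Sminus m eta A
           (\<lambda>j s. (int_op (kM eta A) m \<mu> j s - (\<gamma> j s - int_op (kN eta A) m \<gamma> j s)) / 2)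
       \<and> (\<forall>j<m. \<forall>s\<in>{0..2 * pi}. \<exists>fp.
            (Phi m eta A \<gamma> \<mu> \<longlongrightarrow> fp) (at (eta j s) within Gregion m eta) \<and>
            A j s * fp = complex_of_real (\<gamma> j s)
               + complex_of_real ((int_op (kM eta A) m \<mu> j s - (\<gamma> j s - int_op (kN eta A) m \<gamma> j s)) / 2)
               + \<i> * complex_of_real (\<mu> j s))"
proof -
  interpret curve_system m eta by unfold_locales (rule assms(2))
  define a b \<psi> :: "nat \<Rightarrow> real \<Rightarrow> complex"
    where "a = (\<lambda>k t. of_real (\<gamma> k t) / A k t)"
      and "b = (\<lambda>k t. of_real (\<mu> k t) / A k t)"
      and "\<psi> = (\<lambda>k t. (of_real (\<gamma> k t) + \<i> * of_real (\<mu> k t)) / A k t)"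
  define h where "h = (\<lambda>j s. (int_op (kM eta A) m \<mu> j s - (\<gamma> j s - int_op (kN eta A) m \<gamma> j s)) / 2)"
  define T where "T = (\<lambda>j s. A j s / pi * pv_cauchy m eta \<psi> j s)"
  have A: "hoelder2pi (A k)" "A k t \<noteq> 0" if "k < m" for k t
    using assms(5) that unfolding admissible_A_def by (auto intro: C1_periodic_hoelder2pi)
  have ab: "hoelder2pi (a k)" "hoelder2pi (b k)" if "k < m" for k
    unfolding a_def b_def using that assms(5-7) by (auto intro: hoelder2pi_quotient)
  have \<psi>_eq: "\<psi> = (\<lambda>k t. a k t + \<i> * b k t)"
    by (intro ext) (simp add: \<psi>_def a_def b_def add_divide_distrib)
  have \<psi>: "hoelder2pi (\<psi> k)" if "k < m" for k
    unfolding \<psi>_eq by (intro hoelder2pi_add hoelder2pi_mult hoelder2pi_const ab that)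
  have ops: "int_op (kM eta A) m u j s = Re (A j s / pi * pv_cauchy m eta (\<lambda>k t. of_real (u k t) / A k t) j s)"
    "int_op (kN eta A) m u j s = Im (A j s / pi * pv_cauchy m eta (\<lambda>k t. of_real (u k t) / A k t) j s)"
    if "in_H m u" "j < m" for u j s
  proof -
    have "kM eta A = (\<lambda>j s k t. Re (kernelMN eta A j s k t))" "kN eta A = (\<lambda>j s k t. Im (kernelMN eta A j s k t))"
      by (intro ext; simp add: kM_def kN_def)+
    then show "int_op (kM eta A) m u j s = Re (A j s / pi * pv_cauchy m eta (\<lambda>k t. of_real (u k t) / A k t) j s)"
      "int_op (kN eta A) m u j s = Im (A j s / pi * pv_cauchy m eta (\<lambda>k t. of_real (u k t) / A k t) j s)"
      using int_op_kernel[OF bounded_linear_Re assms(5) that] int_op_kernel[OF bounded_linear_Im assms(5) that]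
      by simp_all
  qed
  have T_parts: "Re (T j s) = int_op (kM eta A) m \<gamma> j s - int_op (kN eta A) m \<mu> j s"
    "Im (T j s) = int_op (kN eta A) m \<gamma> j s + int_op (kM eta A) m \<mu> j s" if "j < m" for j s
  proof -
    \<comment> \<open>\<open>X\<close> carries the operators applied to \<gamma> and
      \<open>Y\<close> those applied to \<mu>; the factor \<open>\<i>\<close> in front of
      \<open>Y\<close> exchanges real and imaginary parts.\<close>
    define X Y where "X = A j s / pi * pv_cauchy m eta a j s" and "Y = A j s / pi * pv_cauchy m eta b j s"
    have "T j s = X + \<i> * Y"
      unfolding T_def \<psi>_eq X_def Y_def by (subst pv_cauchy_linear[OF that ab]) (simp_all add: algebra_simps)
    then have "Re (T j s) = Re X - Im Y" "Im (T j s) = Im X + Re Y" by simp_all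
    then show "Re (T j s) = int_op (kM eta A) m \<gamma> j s - int_op (kN eta A) m \<mu> j s"
      "Im (T j s) = int_op (kN eta A) m \<gamma> j s + int_op (kM eta A) m \<mu> j s"
      unfolding ops[OF assms(6) that] ops[OF assms(7) that] X_def Y_def a_def b_def by (simp_all only:)
  qed
  \<comment> \<open>The integral equation identifies the real part, the definition of
    \<open>h\<close> the imaginary part.\<close>
  have T_eq: "T j s = - of_real (\<mu> j s) + \<i> * (2 * of_real (h j s) + of_real (\<gamma> j s))"
    if "j < m" "s \<in> {0..2 * pi}" for j s
  proof -
    have "\<mu> j s - int_op (kN eta A) m \<mu> j s = - int_op (kM eta A) m \<gamma> j s"
      using assms(8) that by blast
    then show ?thesis using T_parts[OF that(1), of s] by (simp add: complex_eq_iff h_def field_simps)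
  qed
  have Phi_eq: "Phi m eta A \<gamma> \<mu> = (\<lambda>z. 1 / (2 * pi * \<i>) * (\<Sum>k<m. cauchy_int (eta k) (\<psi> k) z))"
    by (intro ext) (simp add: Phi_def cauchy_int_def \<psi>_def)
  \<comment> \<open>\<open>w\<close> is the winding number about the j-th curve: 0 on G and -1
    inside the curve. For \<open>w = -1\<close> the term with \<gamma> and \<mu> drops out and
    \<open>h / A\<close> remains.\<close>
  have bd: "(Phi m eta A \<gamma> \<mu> \<longlongrightarrow> (of_real (h j s) + (\<gamma> j s + \<i> * \<mu> j s) * (1 + of_real w)) / A j s)
      (at (eta j s) within S)"
    if j: "j < m" and s: "s \<in> {0..2 * pi}" and S: "S \<inter> range (eta j) = {}"
      "\<And>z. z \<in> S \<Longrightarrow> integral {0..2 * pi} (\<lambda>t. C2_loop.\<eta>' (eta j) t / (eta j t - z)) = 2 * pi * \<i> * of_real w"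
    for j s S and w :: real
  proof -
    have "(Phi m eta A \<gamma> \<mu> \<longlongrightarrow> 1 / (2 * pi * \<i>) *
        (pv_cauchy m eta \<psi> j s + pi * \<i> * \<psi> j s + \<psi> j s * (2 * pi * \<i> * of_real w))) (at (eta j s) within S)"
      unfolding Phi_eq by (intro tendsto_mult_left cauchy_sum_boundary_limit j \<psi> S)
    also have "1 / (2 * pi * \<i>) * (pv_cauchy m eta \<psi> j s + pi * \<i> * \<psi> j s + \<psi> j s * (2 * pi * \<i> * of_real w)) =
        (of_real (h j s) + (\<gamma> j s + \<i> * \<mu> j s) * (1 + of_real w)) / A j s"
    proof -
      have pv: "pv_cauchy m eta \<psi> j s = pi * (- of_real (\<mu> j s) + \<i> * (2 * of_real (h j s) + of_real (\<gamma> j s))) / A j s"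
        unfolding T_eq[OF j s, symmetric] using A(2)[OF j] by (simp add: T_def)
      have psi: "\<psi> j s = (\<gamma> j s + \<i> * \<mu> j s) / A j s" by (simp add: \<psi>_def)
      show ?thesis unfolding pv psi using A(2)[OF j, of s] by (simp add: field_simps)
    qed
    finally show ?thesis .
  qed
  have "in_Sminus m eta A h"
    unfolding in_Sminus_def
  proof (intro conjI exI allI impI ballI)
    show "in_H m h"
      unfolding in_H_def
    proof (intro allI impI)
      fix j assume j: "j < m"
      have "hoelder2pi (\<lambda>s. A j s * (1 / pi) * pv_cauchy m eta \<psi> j s)"
        by (intro hoelder2pi_mult A hoelder2pi_const pv_cauchy_hoelder j \<psi>)
      then have T: "hoelder2pi (T j)" by (simp add: T_def[abs_def])
      \<comment> \<open>Based on \<open>T_parts\<close>, which holds for every real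
        \<open>s\<close>; the integral equation, and with it \<open>T_eq\<close>, is available on
        one period only.\<close>
      have "hoelder2pi (\<lambda>s. (1 / 2) * (of_real (Im (T j s)) + (-1) * of_real (\<gamma> j s)))"
        using assms(6) j unfolding in_H_def
        by (intro hoelder2pi_add hoelder2pi_mult hoelder2pi_const hoelder2pi_Im T hoelder2pi_of_real) auto
      then have "hoelder2pi (\<lambda>s. complex_of_real (h j s))"
        by (simp add: T_parts[OF j] h_def algebra_simps add_divide_distrib diff_divide_distrib)
      then show "periodic2pi (h j) \<and> holder_on {0..2 * pi} (h j)"
        using hoelder2pi_imp_holder_on by blast
    qed
    have "Phi m eta A \<gamma> \<mu> holomorphic_on Gminus m eta"
      unfolding Phi_eq using Gminus_off_curves
      by (intro holomorphic_intros holomorphic_on_subset[OF C2_loop.cauchy_int_holomorphic[OF loop \<psi>]]) auto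
    then show "Phi m eta A \<gamma> \<mu> analytic_on Gminus m eta"
      using open_Gminus by (simp add: analytic_on_open)
    fix j s assume j: "j < m" and s: "s \<in> {0..2 * pi}"
    show "(Phi m eta A \<gamma> \<mu> \<longlongrightarrow> of_real (h j s) / A j s) (at (eta j s) within Gminus m eta)"
      unfolding at_within_Gminus[OF j]
      using bd[OF j s, of "inside (range (eta j))" "-1"] C2_loop.winding_inside[OF loop[OF j]]
        inside_no_overlap[of "range (eta j)"] by (simp add: Int_commute)
    show "complex_of_real (h j s) = A j s * (of_real (h j s) / A j s)" using A(2)[OF j] by simp
  qed
  moreover have "\<exists>fp. (Phi m eta A \<gamma> \<mu> \<longlongrightarrow> fp) (at (eta j s) within Gregion m eta) \<and>
      A j s * fp = of_real (\<gamma> j s) + of_real (h j s) + \<i> * of_real (\<mu> j s)"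
    if j: "j < m" and s: "s \<in> {0..2 * pi}" for j s
  proof (intro exI conjI)
    have "Gregion m eta \<inter> range (eta j) = {}"
      using Gregion_outside[OF _ j] outside_no_overlap[of "range (eta j)"] by blast
    then show "(Phi m eta A \<gamma> \<mu> \<longlongrightarrow> (of_real (h j s) + (\<gamma> j s + \<i> * \<mu> j s) * (1 + of_real 0)) / A j s)
        (at (eta j s) within Gregion m eta)"
      using C2_loop.winding_outside[OF loop[OF j]] Gregion_outside[OF _ j] by (intro bd j s) auto
    show "A j s * ((of_real (h j s) + (\<gamma> j s + \<i> * \<mu> j s) * (1 + of_real 0)) / A j s) =
        of_real (\<gamma> j s) + of_real (h j s) + \<i> * of_real (\<mu> j s)"
      using A(2)[OF j, of s] by simp
  qed
  ultimately show ?thesis unfolding h_def by blast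
qed

end
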